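(* Let $d$ be a prime power and let $F$ be the finite field with $d$ elements. Let $G$ be the bipartite graph whose two parts are a set of "lines" $L$ and a set of "points" $P$, each part being a copy of the set of triples $\{(1,b,c): b,c\in F,\ (b,c)\ne(0,0)\}$, in which a line $L=(1,a,b)$ is adjacent to a point $P=(1,x,y)$ if and only if $L\cdot P=1+ax+by=0$ in $F$. Then $G$ is $d$-regular, has $2d^2-2$ vertices, girth $6$ and diameter $4$. The spectrum of (the adjacency matrix of) $G$ is $\pm d$ (once each), $\pm\sqrt d$ ($d^2-d-2$ times each) and $\pm1$ ($d$ times each). Consequently its algebraic connectivity is $d-\sqrt d$, so that $G$ attains the upper bound $d-\sqrt d$ on the algebraic connectivity of $d$-regular graphs of diameter $4$.
   Context: The algebraic connectivity of a graph is the second smallest eigenvalue (counted with multiplicity) of its Laplacian matrix (degree matrix minus adjacency matrix); for a $d$-regular graph it is $d$ minus the second largest adjacency eigenvalue. The graph $G$ is a subgraph of the point-line incidence graph of the projective plane $PG(2,d)$ over $F$, in which points and lines are nonzero triples over $F$ up to scalar multiplication and incidence means zero dot product.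
   Formalization: For d = 2 the graph G is a 6-cycle, with diameter 3 and algebraic connectivity 1, so the claims of diameter 4 and algebraic connectivity d − √d (hence of attaining the bound) are made only for d ≠ 2; all other claims cover every prime power d. *)

theory Defs
  imports
    "Graph_Theory.Graph_Theory"
    "Jordan_Normal_Form.Char_Poly"
    "HOL-Number_Theory.Prime_Powers"
    "HOL-Library.Extended_Nat"
begin

text \<open>
  Finite simple graphs are the loop-free symmetric digraphs without parallel arcs satisfying
  \<^const>\<open>pair_graph\<close>; every undirected edge is represented by its two arcs.
\<close>

definition regular_graph :: "nat \<Rightarrow> 'v pair_pre_digraph \<Rightarrow> bool" where
  "regular_graph k G \<longleftrightarrow> (\<forall>v\<in>pverts G. out_degree (with_proj G) v = k)"

text \<open>
  The distance is the shortest-path distance \<^const>\<open>wf_digraph.\<mu>\<close> with all weights equal to 1.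
  It is \<open>\<infinity>\<close> between different components, so a disconnected graph has diameter \<open>\<infinity>\<close>.
\<close>

definition graph_diameter :: "'v pair_pre_digraph \<Rightarrow> ereal" where
  "graph_diameter G =
     (SUP u\<in>pverts G. SUP v\<in>pverts G. wf_digraph.\<mu> (with_proj G) (\<lambda>_. 1) u v)"

text \<open>
  In a symmetric digraph an edge traversed back and forth is a \<^const>\<open>pre_digraph.cycle\<close> of
  length 2; it is excluded here.
\<close>

definition girth :: "'v pair_pre_digraph \<Rightarrow> enat" where
  "girth G = (INF p\<in>{p. pre_digraph.cycle (with_proj G) p \<and> 3 \<le> length p}. enat (length p))"

text \<open>
  Matrices are indexed by positions in a list enumerating the vertices. Different enumerations
  give matrices that differ by a simultaneous permutation of rows and columns, so the spectra
  below do not depend on the enumeration that is chosen.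
\<close>

definition vertex_list :: "'v pair_pre_digraph \<Rightarrow> 'v list" where
  "vertex_list G = (SOME vs. distinct vs \<and> set vs = pverts G)"

definition adjacency_matrix :: "'v pair_pre_digraph \<Rightarrow> real mat" where
  "adjacency_matrix G = (let vs = vertex_list G; n = length vs in
     mat n n (\<lambda>(i, j). if (vs ! i, vs ! j) \<in> parcs G then 1 else 0))"

definition degree_matrix :: "'v pair_pre_digraph \<Rightarrow> real mat" where
  "degree_matrix G = (let vs = vertex_list G; n = length vs in
     mat n n (\<lambda>(i, j). if i = j then real (out_degree (with_proj G) (vs ! i)) else 0))"

definition laplacian_matrix :: "'v pair_pre_digraph \<Rightarrow> real mat" where
  "laplacian_matrix G = degree_matrix G - adjacency_matrix G"

text \<open>
  The multiset of real eigenvalues with multiplicity. For the symmetric matrices above all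
  eigenvalues are real, and algebraic and geometric multiplicities agree.
\<close>

definition spectrum_mset :: "real mat \<Rightarrow> real multiset" where
  "spectrum_mset A = proots (char_poly A)"

definition algebraic_connectivity :: "'v pair_pre_digraph \<Rightarrow> real" where
  "algebraic_connectivity G =
     sorted_list_of_multiset (spectrum_mset (laplacian_matrix G)) ! 1"

type_synonym 'f triple = "'f \<times> 'f \<times> 'f"

fun dot :: "'f::field triple \<Rightarrow> 'f triple \<Rightarrow> 'f" where
  "dot (a, b, c) (x, y, z) = a * x + b * y + c * z"

definition triples :: "'f::field triple set" where
  "triples = {(1, b, c) | b c. (b, c) \<noteq> (0, 0)}"

datatype 'f vertex = Line "'f triple" | Point "'f triple"

definition line_point_graph :: "'f::field vertex pair_pre_digraph" where
  "line_point_graph =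
     \<lparr> pverts = Line ` triples \<union> Point ` triples,
       parcs = {(Line l, Point p) | l p. l \<in> triples \<and> p \<in> triples \<and> dot l p = 0}
             \<union> {(Point p, Line l) | l p. l \<in> triples \<and> p \<in> triples \<and> dot l p = 0} \<rparr>"

end

theory Submission
  imports Defs
begin

text \<open>
  The eigenvalues of the line-point graph come from counting common neighbours. Write \<open>d\<close> for the
  order of the field and call \<open>(1, b, c)\<close> and \<open>(1, b', c')\<close> parallel if \<open>(b, c)\<close> and \<open>(b', c')\<close>
  are proportional. This is an equivalence relation on the \<open>d\<^sup>2 - 1\<close> triples, with classes of size
  \<open>d - 1\<close>. Cramer's rule shows that two distinct lines meet in exactly one point if they are not
  parallel, and in none if they are (\<open>card_common_incident\<close>). Since the dot product is symmetric, the
  same holds for points, and so on each side the square of the adjacency matrix is \<open>d I + J - K\<close>,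
  where \<open>J\<close> is the all-ones matrix and \<open>K\<close> is the indicator matrix of parallelism. Summing an
  eigenvector over everything and over the classes leaves only \<open>d\<^sup>2\<close>, \<open>d\<close> and \<open>1\<close> as
  eigenvalues of the square (\<open>incidence_square_eigenvalue\<close>). So the adjacency eigenvalues are among
  \<open>\<plusminus>d\<close>, \<open>\<plusminus>sqrt d\<close> and \<open>\<plusminus>1\<close>. Their six multiplicities are determined by the traces of the
  powers \<open>0, \<dots>, 5\<close> of the adjacency matrix (\<open>moment_equations\<close>): the odd ones vanish because the
  graph is bipartite, and the even ones are sums over the entries of \<open>d I + J - K\<close>.

  The same count gives the metric properties. Two lines share at most one point, so there is no
  4-cycle, and a bipartite graph without one has girth at least \<open>6\<close>. A hexagon can be written down
  over any field. Two distinct parallel lines, which exist once \<open>d > 2\<close>, have distance at least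
  \<open>4\<close>, and every pair of vertices is joined by a walk of length at most \<open>4\<close>.

  For the bound on an arbitrary \<open>d\<close>-regular graph of diameter \<open>4\<close>, take vertices \<open>u\<close> and \<open>v\<close> with
  distance greater than \<open>3\<close>. The stars around them, each a copy of \<open>K\<^bsub>1,d\<^esub>\<close>, are disjoint and no
  edge joins them. The function with value \<open>sqrt d\<close> at the centre of a star, \<open>1\<close> at its leaves and
  \<open>0\<close> elsewhere has Rayleigh quotient at most \<open>d - sqrt d\<close> for the Laplacian
  (\<open>star_function_Rayleigh\<close>). Hence so does every nonzero combination of the two functions, and some
  such combination is orthogonal to the first eigenvector, which bounds the second smallest eigenvalue
  (\<open>second_eigenvalue_le_two_test_functions\<close>).

  Both halves rest on the spectral theorem for real symmetric matrices, in a form that allows the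
  eigenvalues to be listed in any chosen order (\<open>real_spectral_theorem\<close>).
\<close>

section \<open>Real symmetric matrices are orthogonally diagonalisable\<close>

lemma scalar_prod_self_zero_iff:
  fixes w :: "real vec" assumes "w \<in> carrier_vec n"
  shows "w \<bullet> w = 0 \<longleftrightarrow> w = 0\<^sub>v n"
proof -
  have "conjugate w = w" by (rule eq_vecI) auto
  then show ?thesis using conjugate_square_eq_0_vec[OF assms] by simp
qed

lemma symmetric_entries:
  assumes "A \<in> carrier_mat n n" "transpose_mat A = A" "i < n" "j < n"
  shows "A $$ (i, j) = A $$ (j, i)"
  using assms by (metis carrier_matD index_transpose_mat(1))

text \<open>
  The usual argument: for an eigenvector \<open>v\<close> of eigenvalue \<open>a\<close> the number \<open>v\<^sup>* A v\<close> equals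
  \<open>a |v|\<^sup>2\<close>, and it is its own complex conjugate because \<open>A\<close> is real and symmetric.
\<close>

lemma real_symmetric_root_real:
  fixes A :: "real mat"
  assumes A: "A \<in> carrier_mat n n" and sym: "transpose_mat A = A"
    and root: "poly (char_poly (map_mat complex_of_real A)) a = 0"
  shows "a \<in> \<real>"
proof -
  let ?A = "map_mat complex_of_real A"
  have cA: "?A \<in> carrier_mat n n" using A by simp
  have "eigenvalue ?A a" using eigenvalue_root_char_poly[OF cA] root by blast
  then obtain v where v: "v \<in> carrier_vec n" "v \<noteq> 0\<^sub>v n" "?A *\<^sub>v v = a \<cdot>\<^sub>v v"
    unfolding eigenvalue_def eigenvector_def using A by auto
  define s where "s = (\<Sum>i<n. \<Sum>j<n. cnj (v $ i) * of_real (A $$ (i, j)) * v $ j)"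
  define N where "N = (\<Sum>i<n. (cmod (v $ i))\<^sup>2)"
  have row: "(\<Sum>j<n. of_real (A $$ (i, j)) * v $ j) = a * v $ i" if "i < n" for i
  proof -
    have "(?A *\<^sub>v v) $ i = a * v $ i" using v that by simp
    moreover have "(?A *\<^sub>v v) $ i = (\<Sum>j<n. of_real (A $$ (i, j)) * v $ j)"
      using v(1) A that by (simp add: scalar_prod_def lessThan_atLeast0)
    ultimately show ?thesis by simp
  qed
  have "s = (\<Sum>i<n. cnj (v $ i) * (a * v $ i))"
    unfolding s_def by (rule sum.cong) (auto simp: row[symmetric] sum_distrib_left mult.assoc)
  also have "\<dots> = a * of_real N"
    unfolding N_def of_real_sum sum_distrib_left
    by (rule sum.cong) (auto simp: complex_norm_square simp del: of_real_power)
  finally have sN: "s = a * of_real N" .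
  have "cnj s = (\<Sum>i<n. \<Sum>j<n. v $ i * of_real (A $$ (i, j)) * cnj (v $ j))"
    unfolding s_def by simp
  also have "\<dots> = (\<Sum>j<n. \<Sum>i<n. v $ i * of_real (A $$ (i, j)) * cnj (v $ j))"
    by (rule sum.swap)
  also have "\<dots> = s" unfolding s_def
    by (intro sum.cong refl) (use symmetric_entries[OF A sym] in \<open>auto simp: mult_ac\<close>)
  finally have "cnj s = s" .
  then have "(cnj a - a) * of_real N = 0" using sN by (simp add: algebra_simps)
  moreover have "N \<noteq> 0"
  proof
    assume "N = 0"
    then have "\<forall>i<n. v $ i = 0" unfolding N_def by (subst (asm) sum_nonneg_eq_0_iff) auto
    with v show False by (auto simp: vec_eq_iff)
  qed
  ultimately have "cnj a = a" by simp
  then show ?thesis using Reals_cnj_iff by blast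
qed

lemma real_symmetric_char_poly_splits:
  fixes A :: "real mat"
  assumes A: "A \<in> carrier_mat n n" and sym: "transpose_mat A = A"
  shows "\<exists>es. char_poly A = (\<Prod>e\<leftarrow>es. [:- e, 1:])"
proof -
  interpret cr: map_poly_inj_idom_hom complex_of_real ..
  let ?A = "map_mat complex_of_real A"
  have cA: "?A \<in> carrier_mat n n" using A by simp
  obtain as where as: "char_poly ?A = (\<Prod>a\<leftarrow>as. [:- a, 1:])"
    using char_poly_factorized[OF cA] by blast
  have "a \<in> \<real>" if "a \<in> set as" for a
  proof -
    have "poly (char_poly ?A) a = 0"
      using that unfolding as poly_prod_list by (auto simp: prod_list_zero_iff o_def)
    then show ?thesis using real_symmetric_root_real[OF A sym] by blast
  qed
  then have as_Re: "map (\<lambda>e. complex_of_real (Re e)) as = as"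
    by (intro map_idI) auto
  have "map_poly complex_of_real (\<Prod>e\<leftarrow>map Re as. [:- e, 1:])
      = (\<Prod>a\<leftarrow>map (\<lambda>e. complex_of_real (Re e)) as. [:- a, 1:])"
    by (simp add: cr.hom_prod_list o_def)
  then have "char_poly ?A = map_poly complex_of_real (\<Prod>e\<leftarrow>map Re as. [:- e, 1:])"
    unfolding as_Re as by simp
  moreover have "char_poly ?A = map_poly complex_of_real (char_poly A)"
    using of_real_hom.char_poly_hom[OF A] .
  ultimately have "char_poly A = (\<Prod>e\<leftarrow>map Re as. [:- e, 1:])" by simp
  then show ?thesis by blast
qed

text \<open>
  The witness is the Householder reflection in the hyperplane orthogonal to \<open>v - e\<^sub>0\<close>, which
  exchanges the unit vectors \<open>v\<close> and \<open>e\<^sub>0\<close>. For \<open>v = e\<^sub>0\<close> the division by \<open>0\<close> makes it the identity.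
\<close>

lemma orthogonal_with_first_column:
  fixes v :: "real vec"
  assumes v: "v \<in> carrier_vec n" "v \<bullet> v = 1" and n: "0 < n"
  shows "\<exists>H \<in> carrier_mat n n. transpose_mat H = H \<and> H * H = 1\<^sub>m n \<and> col H 0 = v"
proof -
  define w where "w = v - unit_vec n 0"
  define q where "q = w \<bullet> w"
  define H where "H = mat n n (\<lambda>(i, j). (if i = j then 1 else 0) - 2 / q * (w $ i * w $ j))"
  have w: "w \<in> carrier_vec n" using v by (simp add: w_def)
  have wi: "w $ i = v $ i - (if i = 0 then 1 else 0)" if "i < n" for i
    using that v by (simp add: w_def)
  have q_sum: "q = (\<Sum>k<n. w $ k * w $ k)"
    using w by (simp add: q_def scalar_prod_def lessThan_atLeast0)
  have "(\<Sum>k<n. v $ k * v $ k) = 1" using v by (simp add: scalar_prod_def lessThan_atLeast0)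
  moreover have "(\<Sum>k<n. w $ k * w $ k)
      = (\<Sum>k<n. v $ k * v $ k + (if k = 0 then 1 - 2 * v $ 0 else 0))"
    by (rule sum.cong) (auto simp: wi algebra_simps)
  ultimately have q0: "q = 2 - 2 * v $ 0"
    using n unfolding q_sum by (simp add: sum.distrib)
  have H: "H \<in> carrier_mat n n" by (simp add: H_def)
  have Ht: "transpose_mat H = H" by (rule eq_matI) (auto simp: H_def mult_ac)
  have HH: "H * H = 1\<^sub>m n"
  proof (rule eq_matI)
    fix i j assume "i < dim_row (1\<^sub>m n :: real mat)" "j < dim_col (1\<^sub>m n :: real mat)"
    then have ij: "i < n" "j < n" by auto
    have "(H * H) $$ (i, j) = (\<Sum>k<n. H $$ (i, k) * H $$ (k, j))"
      using H ij by (simp add: scalar_prod_def lessThan_atLeast0)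
    also have "\<dots> = (\<Sum>k<n. (if k = i then (if i = j then 1 else 0) - 2 / q * (w $ i * w $ j) else 0)
        + (if k = j then - (2 / q * (w $ i * w $ j)) else 0)
        + (2 / q)\<^sup>2 * (w $ i * w $ j) * (w $ k * w $ k))"
      using ij by (intro sum.cong) (auto simp: H_def algebra_simps power2_eq_square)
    also have "\<dots> = (if i = j then 1 else 0) - 4 / q * (w $ i * w $ j)
        + (2 / q)\<^sup>2 * (w $ i * w $ j) * q"
      using ij by (simp add: sum.distrib q_sum sum_distrib_left[symmetric])
    also have "\<dots> = (if i = j then 1 else 0)"
      by (cases "q = 0") (auto simp: power2_eq_square)
    finally show "(H * H) $$ (i, j) = 1\<^sub>m n $$ (i, j)" using ij by simp
  qed (use H in auto)
  have "col H 0 = v"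
  proof (rule eq_vecI)
    fix i assume "i < dim_vec v"
    then have i: "i < n" using v by simp
    have "H $$ (i, 0) = v $ i"
    proof (cases "q = 0")
      case True
      then have "w = 0\<^sub>v n" using scalar_prod_self_zero_iff[OF w] q_def by simp
      then have "w $ i = 0" using i by simp
      then have "v $ i = (if i = 0 then 1 else 0)" using wi[OF i] by simp
      then show ?thesis using True i n by (simp add: H_def)
    next
      case False
      have "2 / q * w $ 0 = -1" using False wi[OF n] q0 by (simp add: field_simps)
      then have "2 / q * (w $ i * w $ 0) = - w $ i"
        by (metis (no_types, opaque_lifting) mult.left_commute mult_minus1_right mult.commute)
      then show ?thesis using i n wi[OF i] by (simp add: H_def)
    qed
    then show "col H 0 $ i = v $ i" using H i n by simp
  qed (use H v in auto)
  then show ?thesis using H Ht HH by auto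
qed

text \<open>
  Deflation: conjugating \<open>A\<close> with a reflection that sends \<open>e\<^sub>0\<close> to an eigenvector of \<open>e\<close> splits off
  the \<open>1 \<times> 1\<close> block \<open>e\<close>, and the induction hypothesis diagonalises the remaining block. Since the
  eigenvalue that is split off can be any root of the characteristic polynomial, the diagonal can
  follow any listing \<open>es\<close> of the roots. The bound on the second eigenvalue uses the sorted one.
\<close>

theorem real_spectral_theorem:
  fixes A :: "real mat"
  assumes "A \<in> carrier_mat n n" "transpose_mat A = A"
    and "char_poly A = (\<Prod>e\<leftarrow>es. [:- e, 1:])"
  shows "\<exists>P \<in> carrier_mat n n. transpose_mat P * P = 1\<^sub>m n
    \<and> transpose_mat P * A * P = mat_diag n (\<lambda>i. es ! i)"
  using assms
proof (induction es arbitrary: n A)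
  case Nil
  then have "n = 0" using degree_monic_char_poly[of A n] by simp
  then show ?case using Nil by (intro bexI[of _ "1\<^sub>m n"]) (auto simp: mat_diag_def intro!: eq_matI)
next
  case (Cons e es)
  note A = Cons.prems(1) and sym = Cons.prems(2) and cp = Cons.prems(3)
  have "eigenvalue A e" unfolding eigenvalue_root_char_poly[OF A] cp by simp
  then obtain x where x: "x \<in> carrier_vec n" "x \<noteq> 0\<^sub>v n" "A *\<^sub>v x = e \<cdot>\<^sub>v x"
    unfolding eigenvalue_def eigenvector_def using A by auto
  have "n \<noteq> 0"
  proof
    assume "n = 0"
    then show False using x by (auto intro!: eq_vecI)
  qed
  then obtain m where n: "n = Suc m" using not0_implies_Suc by blast
  define r where "r = 1 / sqrt (x \<bullet> x)"
  define v where "v = r \<cdot>\<^sub>v x"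
  have "x \<bullet> x \<noteq> 0" using scalar_prod_self_zero_iff[OF x(1)] x(2) by simp
  moreover have "x \<bullet> x \<ge> 0" by (simp add: scalar_prod_def sum_nonneg)
  ultimately have "x \<bullet> x > 0" by simp
  then have "r * r * (x \<bullet> x) = 1" by (simp add: r_def)
  then have v: "v \<in> carrier_vec n" "v \<bullet> v = 1" "A *\<^sub>v v = e \<cdot>\<^sub>v v"
    using x A by (auto simp: v_def mult_mat_vec smult_smult_assoc mult_ac)
  obtain H where H: "H \<in> carrier_mat n n" and Ht: "transpose_mat H = H"
    and HH: "H * H = 1\<^sub>m n" and Hv: "col H 0 = v"
    using orthogonal_with_first_column[OF v(1,2)] n by blast
  define B where "B = H * A * H"
  have B: "B \<in> carrier_mat n n" using H A by (simp add: B_def)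
  have Bsym: "transpose_mat B = B"
    using H A by (simp add: B_def transpose_mult[of _ n n _ n] Ht sym assoc_mult_mat[of _ n n _ n _ n])
  have Hv0: "H *\<^sub>v v = unit_vec n 0"
  proof -
    have "H *\<^sub>v v = col (H * H) 0" using col_mult2[OF H H] n Hv by simp
    then show ?thesis using HH n by (auto intro!: eq_vecI)
  qed
  have colB: "col B 0 = e \<cdot>\<^sub>v unit_vec n 0"
  proof -
    have "col B 0 = (H * A) *\<^sub>v v" using col_mult2[OF mult_carrier_mat[OF H A] H, of 0] n Hv by (simp add: B_def)
    also have "\<dots> = H *\<^sub>v (A *\<^sub>v v)" using H A v by (simp add: assoc_mult_mat_vec[of _ n n _ n])
    also have "\<dots> = e \<cdot>\<^sub>v unit_vec n 0" using H v Hv0 by (simp add: mult_mat_vec)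
    finally show ?thesis .
  qed
  have B0: "B $$ (i, 0) = (if i = 0 then e else 0)" if "i < n" for i
    using arg_cong[OF colB, of "\<lambda>u. u $ i"] B that n by simp
  define B' where "B' = mat m m (\<lambda>(i, j). B $$ (Suc i, Suc j))"
  define E where "E = mat 1 1 (\<lambda>_. e)"
  have B': "B' \<in> carrier_mat m m" and E: "E \<in> carrier_mat 1 1" by (simp_all add: B'_def E_def)
  have B'sym: "transpose_mat B' = B'"
    using symmetric_entries[OF B Bsym] by (auto simp: B'_def n intro!: eq_matI)
  have Bblock: "B = four_block_mat E (0\<^sub>m 1 m) (0\<^sub>m m 1) B'"
  proof (rule eq_matI)
    fix i j assume "i < dim_row (four_block_mat E (0\<^sub>m 1 m) (0\<^sub>m m 1) B')"
      "j < dim_col (four_block_mat E (0\<^sub>m 1 m) (0\<^sub>m m 1) B')"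
    then have ij: "i < n" "j < n" using E B' n by auto
    have "B $$ (0, j) = (if j = 0 then e else 0)"
      using B0[OF ij(2)] symmetric_entries[OF B Bsym, of 0 j] ij n by simp
    then show "B $$ (i, j) = four_block_mat E (0\<^sub>m 1 m) (0\<^sub>m m 1) B' $$ (i, j)"
      using ij B0[OF ij(1)] n by (cases i; cases j) (auto simp: E_def B'_def)
  qed (use B B' E n in auto)
  have "similar_mat A B"
    unfolding similar_mat_def similar_mat_wit_def
  proof (intro exI)
    show "let n = dim_row A in {A, B, H, H} \<subseteq> carrier_mat n n \<and> H * H = 1\<^sub>m n \<and> H * H = 1\<^sub>m n
        \<and> A = H * B * H"
    proof -
      have "H * B * H = (H * H) * A * (H * H)"
        using H A by (simp add: B_def assoc_mult_mat[of _ n n _ n _ n])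
      also have "\<dots> = A" using A HH by simp
      finally show ?thesis using A B H HH by (auto simp: Let_def)
    qed
  qed
  then have "char_poly A = char_poly B" by (rule char_poly_similar)
  also have "\<dots> = char_poly E * char_poly B'"
    unfolding Bblock by (rule char_poly_four_block_zeros_col[OF E _ B']) simp
  also have "char_poly E = [:- e, 1:]"
    by (simp add: char_poly_defs E_def det_single)
  finally have "[:- e, 1:] * char_poly B' = [:- e, 1:] * (\<Prod>e\<leftarrow>es. [:- e, 1:])"
    using cp by simp
  then have "char_poly B' = (\<Prod>e\<leftarrow>es. [:- e, 1:])"
    by (metis mult_cancel_left pCons_eq_0_iff one_neq_zero)
  from Cons.IH[OF B' B'sym this] obtain P' where P': "P' \<in> carrier_mat m m"
    and P'o: "transpose_mat P' * P' = 1\<^sub>m m"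
    and P'd: "transpose_mat P' * B' * P' = mat_diag m (\<lambda>i. es ! i)" by blast
  define Q where "Q = four_block_mat (1\<^sub>m 1) (0\<^sub>m 1 m) (0\<^sub>m m 1) P'"
  have Q: "Q \<in> carrier_mat n n" using P' n by (auto simp: Q_def)
  have Qt: "transpose_mat Q = four_block_mat (1\<^sub>m 1) (0\<^sub>m 1 m) (0\<^sub>m m 1) (transpose_mat P')"
    unfolding Q_def by (subst transpose_four_block_mat[of _ 1 1 _ m _ m]) (use P' in auto)
  have Qo: "transpose_mat Q * Q = 1\<^sub>m n"
    unfolding Qt unfolding Q_def
    by (subst mult_four_block_mat[of _ 1 1 _ m _ m]) (use P' P'o n in auto)
  have Qd: "transpose_mat Q * B * Q = mat_diag n (\<lambda>i. (e # es) ! i)"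
  proof -
    have "transpose_mat Q * B = four_block_mat E (0\<^sub>m 1 m) (0\<^sub>m m 1) (transpose_mat P' * B')"
      unfolding Qt Bblock
      by (subst mult_four_block_mat[of _ 1 1 _ m _ m]) (use P' B' E in auto)
    then have "transpose_mat Q * B * Q
        = four_block_mat E (0\<^sub>m 1 m) (0\<^sub>m m 1) (transpose_mat P' * B' * P')"
      unfolding Q_def
      by (simp, subst mult_four_block_mat[of _ 1 1 _ m _ m]) (use P' B' E in auto)
    also have "\<dots> = mat_diag n (\<lambda>i. (e # es) ! i)"
      unfolding P'd by (rule eq_matI) (auto simp: mat_diag_def E_def n)
    finally show ?thesis .
  qed
  have PT: "transpose_mat (H * Q) = transpose_mat Q * H"
    using H Q by (simp add: transpose_mult[of _ n n _ n] Ht)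
  have Qt': "transpose_mat Q \<in> carrier_mat n n" using Q by simp
  have "transpose_mat (H * Q) * (H * Q) = transpose_mat Q * ((H * H) * Q)"
    unfolding PT using H Q Qt' by (simp add: assoc_mult_mat[of _ n n _ n _ n])
  then have 1: "transpose_mat (H * Q) * (H * Q) = 1\<^sub>m n" using HH Q Qo by simp
  have "transpose_mat (H * Q) * A * (H * Q) = transpose_mat Q * B * Q"
    unfolding PT B_def using H Q Qt' A by (simp add: assoc_mult_mat[of _ n n _ n _ n])
  then have 2: "transpose_mat (H * Q) * A * (H * Q) = mat_diag n (\<lambda>i. (e # es) ! i)"
    using Qd by simp
  show ?case using 1 2 H Q by (intro bexI[of _ "H * Q"]) auto
qed

lemma proots_linear_factors:
  fixes es :: "'a::idom list"
  shows "proots (\<Prod>e\<leftarrow>es. [:- e, 1:]) = mset es"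
proof (induction es)
  case (Cons e es)
  have "(\<Prod>e\<leftarrow>es. [:- e, 1:]) \<noteq> 0"
    by (auto simp: prod_list_zero_iff)
  then have "proots ([:- e, 1:] * (\<Prod>e\<leftarrow>es. [:- e, 1:])) = {#e#} + mset es"
    by (subst proots_mult) (use Cons in auto)
  then show ?case by simp
qed simp

lemma real_symmetric_char_poly_spectrum:
  assumes A: "A \<in> carrier_mat n n" and sym: "transpose_mat A = A"
    and es: "mset es = spectrum_mset A"
  shows "char_poly A = (\<Prod>e\<leftarrow>es. [:- e, 1:])" and "length es = n"
proof -
  obtain es' where es': "char_poly A = (\<Prod>e\<leftarrow>es'. [:- e, 1:])"
    using real_symmetric_char_poly_splits[OF A sym] by blast
  then have "mset es' = mset es"
    using es by (simp add: spectrum_mset_def proots_linear_factors)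
  then have "mset (map (\<lambda>e. [:- e, 1:]) es') = mset (map (\<lambda>e. [:- e, 1:]) es)" by simp
  then show *: "char_poly A = (\<Prod>e\<leftarrow>es. [:- e, 1:])"
    unfolding es' by (metis prod_mset_prod_list)
  have "degree (\<Prod>e\<leftarrow>es. [:- e, 1:]) = length es"
  proof (induction es)
    case (Cons a es)
    have "(\<Prod>e\<leftarrow>es. [:- e, 1:]) \<noteq> 0" by (auto simp: prod_list_zero_iff)
    then have "degree ([:- a, 1:] * (\<Prod>e\<leftarrow>es. [:- e, 1:])) = 1 + length es"
      by (subst degree_mult_eq) (use Cons in auto)
    then show ?case by simp
  qed simp
  then show "length es = n" using degree_monic_char_poly[OF A] * by simp
qed

lemma mat_diagonalised_eq:
  fixes A :: "real mat"
  assumes A: "A \<in> carrier_mat n n" and P: "P \<in> carrier_mat n n"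
    and o: "transpose_mat P * P = 1\<^sub>m n" and d: "transpose_mat P * A * P = mat_diag n f"
  shows "P * transpose_mat P = 1\<^sub>m n" and "A = P * mat_diag n f * transpose_mat P"
proof -
  have Pt: "transpose_mat P \<in> carrier_mat n n" using P by simp
  show o': "P * transpose_mat P = 1\<^sub>m n" using mat_mult_left_right_inverse[OF Pt P o] .
  have "P * mat_diag n f * transpose_mat P = (P * transpose_mat P) * A * (P * transpose_mat P)"
    unfolding d[symmetric] using A P Pt by (simp add: assoc_mult_mat[of _ n n _ n _ n])
  then show "A = P * mat_diag n f * transpose_mat P" using o' A by simp
qed

text \<open>
  Used for the Laplacian of a regular graph, which is \<open>d I\<close> minus the adjacency matrix.
\<close>

lemma spectrum_mset_reflect:
  fixes A :: "real mat"
  assumes A: "A \<in> carrier_mat n n" and sym: "transpose_mat A = A"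
  shows "spectrum_mset (c \<cdot>\<^sub>m 1\<^sub>m n - A) = image_mset (\<lambda>x. c - x) (spectrum_mset A)"
proof -
  let ?L = "c \<cdot>\<^sub>m 1\<^sub>m n - A"
  obtain es where es: "mset es = spectrum_mset A" using ex_mset by blast
  note cp = real_symmetric_char_poly_spectrum[OF A sym es]
  obtain P where P: "P \<in> carrier_mat n n" and o: "transpose_mat P * P = 1\<^sub>m n"
    and d: "transpose_mat P * A * P = mat_diag n (\<lambda>i. es ! i)"
    using real_spectral_theorem[OF A sym cp(1)] by blast
  note inv = mat_diagonalised_eq[OF A P o d]
  define f where "f = (\<lambda>i. c - es ! i)"
  have Pt: "transpose_mat P \<in> carrier_mat n n" using P by simp
  have D: "mat_diag n f = c \<cdot>\<^sub>m 1\<^sub>m n - mat_diag n (\<lambda>i. es ! i)"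
    by (rule eq_matI) (auto simp: f_def mat_diag_def)
  have "P * mat_diag n f * transpose_mat P
      = c \<cdot>\<^sub>m (P * transpose_mat P) - P * mat_diag n (\<lambda>i. es ! i) * transpose_mat P"
    unfolding D using P Pt
    by (simp add: mult_minus_distrib_mat[of _ n n _ n] minus_mult_distrib_mat[of _ n n _ _ n]
        mult_smult_distrib[of _ n n _ n] mult_smult_assoc_mat[of _ n n _ n])
  then have L: "?L = P * mat_diag n f * transpose_mat P" using inv by simp
  have "similar_mat ?L (mat_diag n f)"
    unfolding similar_mat_def similar_mat_wit_def
    by (intro exI[of _ P] exI[of _ "transpose_mat P"]) (use A P Pt o inv L in \<open>auto simp: Let_def\<close>)
  then have "char_poly ?L = char_poly (mat_diag n f)" by (rule char_poly_similar)
  also have "\<dots> = (\<Prod>e\<leftarrow>diag_mat (mat_diag n f). [:- e, 1:])"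
    by (rule char_poly_upper_triangular[of _ n]) (auto simp: mat_diag_def)
  also have "diag_mat (mat_diag n f) = map (\<lambda>x. c - x) es"
    using cp(2) by (auto simp: diag_mat_def mat_diag_def f_def list_eq_iff_nth_eq)
  finally have "spectrum_mset ?L = mset (map (\<lambda>x. c - x) es)"
    by (simp only: spectrum_mset_def proots_linear_factors)
  then show ?thesis using es by simp
qed

section \<open>Orthonormal eigenfunctions and the second smallest eigenvalue\<close>

text \<open>
  The spectral decomposition of the matrix \<open>a\<close> with rows and columns indexed by \<open>V\<close>: the functions
  \<open>\<phi> i\<close> are the columns of an orthogonal matrix, the first two conditions say that it is orthogonal
  from either side, and the third says that it diagonalises \<open>a\<close>. Stated for functions on the vertex
  set, it does not mention the enumeration of the vertices.
\<close>

definition orthonormal_eigenfunctions ::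
    "'v set \<Rightarrow> ('v \<Rightarrow> 'v \<Rightarrow> real) \<Rightarrow> real list \<Rightarrow> (nat \<Rightarrow> 'v \<Rightarrow> real) \<Rightarrow> bool" where
  "orthonormal_eigenfunctions V a es \<phi> \<longleftrightarrow>
     (\<forall>i<length es. \<forall>j<length es. (\<Sum>v\<in>V. \<phi> i v * \<phi> j v) = (if i = j then 1 else 0)) \<and>
     (\<forall>u\<in>V. \<forall>v\<in>V. (\<Sum>i<length es. \<phi> i u * \<phi> i v) = (if u = v then 1 else 0)) \<and>
     (\<forall>u\<in>V. \<forall>v\<in>V. (\<Sum>i<length es. es ! i * \<phi> i u * \<phi> i v) = a u v)"

lemma sum_nth_distinct:
  assumes "distinct vs"
  shows "(\<Sum>i<length vs. f (vs ! i)) = sum f (set vs)"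
  by (rule sum.reindex_bij_betw) (use bij_betw_nth[OF assms] in auto)

lemma orthonormal_eigenfunctions_exist:
  fixes a :: "'v \<Rightarrow> 'v \<Rightarrow> real"
  assumes vs: "distinct vs" and sym: "\<And>u v. u \<in> set vs \<Longrightarrow> v \<in> set vs \<Longrightarrow> a u v = a v u"
    and es: "mset es = spectrum_mset (mat (length vs) (length vs) (\<lambda>(i, j). a (vs ! i) (vs ! j)))"
  shows "\<exists>\<phi>. orthonormal_eigenfunctions (set vs) a es \<phi>"
proof -
  define n where "n = length vs"
  define A where "A = mat n n (\<lambda>(i, j). a (vs ! i) (vs ! j))"
  have A: "A \<in> carrier_mat n n" by (simp add: A_def)
  have At: "transpose_mat A = A" by (rule eq_matI) (auto simp: A_def n_def sym)
  have es': "mset es = spectrum_mset A" using es by (simp add: A_def n_def)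
  note cp = real_symmetric_char_poly_spectrum[OF A At es']
  obtain P where P: "P \<in> carrier_mat n n" and o: "transpose_mat P * P = 1\<^sub>m n"
    and d: "transpose_mat P * A * P = mat_diag n (\<lambda>i. es ! i)"
    using real_spectral_theorem[OF A At cp(1)] by blast
  note inv = mat_diagonalised_eq[OF A P o d]
  define pos where "pos = inv_into {..<n} (\<lambda>i. vs ! i)"
  have pos: "pos (vs ! i) = i" if "i < n" for i
    unfolding pos_def using that vs by (intro inv_into_f_f) (auto simp: inj_on_def nth_eq_iff_index_eq n_def)
  define \<phi> where "\<phi> i v = P $$ (pos v, i)" for i v
  have ex: "\<exists>i<n. v = vs ! i" if "v \<in> set vs" for v
    using that by (metis in_set_conv_nth n_def)
  have 1: "(\<Sum>v\<in>set vs. \<phi> i v * \<phi> j v) = (if i = j then 1 else 0)" if "i < n" "j < n" for i j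
  proof -
    have "(\<Sum>v\<in>set vs. \<phi> i v * \<phi> j v) = (\<Sum>k<n. P $$ (k, i) * P $$ (k, j))"
      unfolding sum_nth_distinct[OF vs, symmetric] by (rule sum.cong) (auto simp: \<phi>_def pos n_def)
    also have "\<dots> = (transpose_mat P * P) $$ (i, j)"
      using P that by (simp add: scalar_prod_def lessThan_atLeast0)
    finally show ?thesis using o that by simp
  qed
  have 2: "(\<Sum>i<n. \<phi> i u * \<phi> i v) = (if u = v then 1 else 0)"
    if "u \<in> set vs" "v \<in> set vs" for u v
  proof -
    obtain k l where kl: "k < n" "u = vs ! k" "l < n" "v = vs ! l" using ex \<open>u \<in> _\<close> \<open>v \<in> _\<close> by metis
    have "(\<Sum>i<n. \<phi> i u * \<phi> i v) = (P * transpose_mat P) $$ (k, l)"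
      using P kl by (simp add: scalar_prod_def lessThan_atLeast0 \<phi>_def pos)
    also have "\<dots> = (if u = v then 1 else 0)"
      using kl vs by (simp add: inv nth_eq_iff_index_eq n_def)
    finally show ?thesis .
  qed
  have 3: "(\<Sum>i<n. es ! i * \<phi> i u * \<phi> i v) = a u v"
    if "u \<in> set vs" "v \<in> set vs" for u v
  proof -
    obtain k l where kl: "k < n" "u = vs ! k" "l < n" "v = vs ! l" using ex \<open>u \<in> _\<close> \<open>v \<in> _\<close> by metis
    have "a u v = A $$ (k, l)" using kl by (simp add: A_def)
    also have "\<dots> = (P * mat_diag n (\<lambda>i. es ! i) * transpose_mat P) $$ (k, l)" using inv(2) by simp
    also have "\<dots> = (\<Sum>i<n. P $$ (k, i) * es ! i * P $$ (l, i))"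
      unfolding mat_diag_mult_right[OF P] using P kl by (simp add: scalar_prod_def lessThan_atLeast0)
    also have "\<dots> = (\<Sum>i<n. es ! i * \<phi> i u * \<phi> i v)"
      by (rule sum.cong) (auto simp: \<phi>_def pos kl)
    finally show ?thesis by simp
  qed
  show ?thesis using 1 2 3 cp(2) unfolding orthonormal_eigenfunctions_def by blast
qed

text \<open>
  The weights \<open>1\<close> give the norm of \<open>h\<close>, and the eigenvalues as weights give its quadratic form.
\<close>

lemma weighted_Parseval:
  fixes h :: "'v \<Rightarrow> real" and w :: "nat \<Rightarrow> real"
  shows "(\<Sum>i<n. w i * (\<Sum>v\<in>V. h v * \<phi> i v)\<^sup>2)
    = (\<Sum>u\<in>V. \<Sum>v\<in>V. h u * (\<Sum>i<n. w i * \<phi> i u * \<phi> i v) * h v)"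
proof -
  have "(\<Sum>i<n. w i * (\<Sum>v\<in>V. h v * \<phi> i v)\<^sup>2)
      = (\<Sum>i<n. \<Sum>u\<in>V. \<Sum>v\<in>V. h u * (w i * \<phi> i u * \<phi> i v) * h v)"
    by (simp add: power2_eq_square sum_product sum_distrib_left mult_ac)
  also have "\<dots> = (\<Sum>u\<in>V. \<Sum>i<n. \<Sum>v\<in>V. h u * (w i * \<phi> i u * \<phi> i v) * h v)"
    by (rule sum.swap)
  also have "\<dots> = (\<Sum>u\<in>V. \<Sum>v\<in>V. \<Sum>i<n. h u * (w i * \<phi> i u * \<phi> i v) * h v)"
    by (intro sum.cong refl sum.swap)
  finally show ?thesis by (simp add: sum_distrib_left sum_distrib_right)
qed

lemma second_eigenvalue_le_Rayleigh:
  assumes \<phi>: "orthonormal_eigenfunctions V a es \<phi>" and V: "finite V" and es: "sorted es"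
    and orth: "(\<Sum>v\<in>V. h v * \<phi> 0 v) = 0"
  shows "es ! 1 * (\<Sum>v\<in>V. (h v)\<^sup>2) \<le> (\<Sum>u\<in>V. \<Sum>v\<in>V. h u * a u v * h v)"
proof -
  let ?c = "\<lambda>i. \<Sum>v\<in>V. h v * \<phi> i v"
  have "(\<Sum>i<length es. 1 * (?c i)\<^sup>2) = (\<Sum>u\<in>V. \<Sum>v\<in>V. h u * (if u = v then 1 else 0) * h v)"
    unfolding weighted_Parseval
    by (intro sum.cong refl) (use \<phi> in \<open>auto simp: orthonormal_eigenfunctions_def\<close>)
  also have "\<dots> = (\<Sum>v\<in>V. (h v)\<^sup>2)"
    using V by (intro sum.cong refl) (simp add: power2_eq_square if_distrib if_distribR sum.delta cong: if_cong)
  finally have "es ! 1 * (\<Sum>v\<in>V. (h v)\<^sup>2) = (\<Sum>i<length es. es ! 1 * (?c i)\<^sup>2)"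
    by (simp add: sum_distrib_left[symmetric])
  also have "\<dots> \<le> (\<Sum>i<length es. es ! i * (?c i)\<^sup>2)"
  proof (rule sum_mono)
    fix i assume "i \<in> {..<length es}"
    then show "es ! 1 * (?c i)\<^sup>2 \<le> es ! i * (?c i)\<^sup>2"
      using orth sorted_nth_mono[OF es, of 1 i] by (cases "i = 0") (auto intro: mult_right_mono)
  qed
  also have "\<dots> = (\<Sum>u\<in>V. \<Sum>v\<in>V. h u * a u v * h v)"
    unfolding weighted_Parseval
    by (intro sum.cong refl) (use \<phi> in \<open>auto simp: orthonormal_eigenfunctions_def\<close>)
  finally show ?thesis .
qed

text \<open>
  This is the Courant-Fischer upper bound for the plane spanned by \<open>f\<close> and \<open>g\<close>. Some nonzero vector
  of that plane is orthogonal to the first eigenfunction, and because the supports do not interact, the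
  Rayleigh quotient on the whole plane is at most \<open>c\<close>.
\<close>

lemma second_eigenvalue_le_two_test_functions:
  fixes a :: "'v \<Rightarrow> 'v \<Rightarrow> real"
  assumes \<phi>: "orthonormal_eigenfunctions V a es \<phi>" and V: "finite V" and es: "sorted es"
    and f: "(\<Sum>u\<in>V. \<Sum>v\<in>V. f u * a u v * f v) \<le> c * (\<Sum>v\<in>V. (f v)\<^sup>2)" "0 < (\<Sum>v\<in>V. (f v)\<^sup>2)"
    and g: "(\<Sum>u\<in>V. \<Sum>v\<in>V. g u * a u v * g v) \<le> c * (\<Sum>v\<in>V. (g v)\<^sup>2)" "0 < (\<Sum>v\<in>V. (g v)\<^sup>2)"
    and disj: "\<And>v. v \<in> V \<Longrightarrow> f v * g v = 0"
    and cross: "\<And>u v. u \<in> V \<Longrightarrow> v \<in> V \<Longrightarrow> f u * a u v * g v = 0"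
      "\<And>u v. u \<in> V \<Longrightarrow> v \<in> V \<Longrightarrow> g u * a u v * f v = 0"
  shows "es ! 1 \<le> c"
proof -
  let ?F = "\<Sum>v\<in>V. f v * \<phi> 0 v" and ?G = "\<Sum>v\<in>V. g v * \<phi> 0 v"
  \<comment> \<open>A nonzero combination of \<open>f\<close> and \<open>g\<close> orthogonal to \<open>\<phi> 0\<close>.\<close>
  obtain p q :: real where pq: "p * ?F + q * ?G = 0" "p \<noteq> 0 \<or> q \<noteq> 0"
  proof (cases "?F = 0")
    case True
    then show ?thesis by (intro that[of 1 0]) auto
  next
    case False
    then show ?thesis by (intro that[of ?G "- ?F"]) auto
  qed
  define h where "h v = p * f v + q * g v" for v
  have h2: "(\<Sum>v\<in>V. (h v)\<^sup>2) = p\<^sup>2 * (\<Sum>v\<in>V. (f v)\<^sup>2) + q\<^sup>2 * (\<Sum>v\<in>V. (g v)\<^sup>2)"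
  proof -
    have "(h v)\<^sup>2 = p\<^sup>2 * (f v)\<^sup>2 + q\<^sup>2 * (g v)\<^sup>2" if "v \<in> V" for v
    proof -
      have "(h v)\<^sup>2 = p\<^sup>2 * (f v)\<^sup>2 + q\<^sup>2 * (g v)\<^sup>2 + 2 * p * q * (f v * g v)"
        by (simp add: h_def power2_eq_square algebra_simps)
      then show ?thesis using disj[OF that] by simp
    qed
    then show ?thesis by (simp add: sum.distrib sum_distrib_left)
  qed
  have hQ: "(\<Sum>u\<in>V. \<Sum>v\<in>V. h u * a u v * h v) =
      p\<^sup>2 * (\<Sum>u\<in>V. \<Sum>v\<in>V. f u * a u v * f v) + q\<^sup>2 * (\<Sum>u\<in>V. \<Sum>v\<in>V. g u * a u v * g v)"
  proof -
    have "h u * a u v * h v = p\<^sup>2 * (f u * a u v * f v) + q\<^sup>2 * (g u * a u v * g v)"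
      if "u \<in> V" "v \<in> V" for u v
    proof -
      have "h u * a u v * h v = p\<^sup>2 * (f u * a u v * f v) + q\<^sup>2 * (g u * a u v * g v)
          + p * q * (f u * a u v * g v) + p * q * (g u * a u v * f v)"
        by (simp add: h_def power2_eq_square algebra_simps)
      then show ?thesis using cross[OF that] by simp
    qed
    then show ?thesis by (simp add: sum.distrib sum_distrib_left)
  qed
  have "(\<Sum>v\<in>V. h v * \<phi> 0 v) = p * ?F + q * ?G"
    by (simp add: h_def sum.distrib sum_distrib_left algebra_simps)
  then have "es ! 1 * (\<Sum>v\<in>V. (h v)\<^sup>2) \<le> (\<Sum>u\<in>V. \<Sum>v\<in>V. h u * a u v * h v)"
    using second_eigenvalue_le_Rayleigh[OF \<phi> V es, of h] pq(1) by simp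
  also have "\<dots> \<le> p\<^sup>2 * (c * (\<Sum>v\<in>V. (f v)\<^sup>2)) + q\<^sup>2 * (c * (\<Sum>v\<in>V. (g v)\<^sup>2))"
    unfolding hQ using f(1) g(1) by (intro add_mono mult_left_mono) auto
  also have "\<dots> = c * (\<Sum>v\<in>V. (h v)\<^sup>2)"
    unfolding h2 by (simp add: algebra_simps)
  finally have "es ! 1 * (\<Sum>v\<in>V. (h v)\<^sup>2) \<le> c * (\<Sum>v\<in>V. (h v)\<^sup>2)" .
  moreover have "0 < (\<Sum>v\<in>V. (h v)\<^sup>2)"
    unfolding h2 using pq(2) f(2) g(2)
    by (metis add_nonneg_pos add_pos_nonneg less_imp_le mult_nonneg_nonneg mult_pos_pos zero_le_power2 zero_less_power2)
  ultimately show ?thesis by simp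
qed

section \<open>The upper bound for regular graphs of diameter 4\<close>

lemma mu_le_length:
  assumes "pair_wf_digraph G" "u \<in> pverts G" "set p \<subseteq> parcs G" "pcas u p v"
  shows "wf_digraph.\<mu> (with_proj G) (\<lambda>_. 1) u v \<le> ereal (length p)"
proof -
  interpret pair_wf_digraph G by fact
  have "awalk u p v" using assms by (simp add: awalk_def)
  then have "\<mu> (\<lambda>_. 1) u v \<le> ereal (awalk_cost (\<lambda>_. 1) p)" by (rule min_cost_le_walk_cost)
  then show ?thesis by (simp add: awalk_cost_def sum_list_triv)
qed

lemma le_mu:
  assumes "pair_wf_digraph G" "\<And>p. set p \<subseteq> parcs G \<Longrightarrow> pcas u p v \<Longrightarrow> k \<le> length p"
  shows "ereal k \<le> wf_digraph.\<mu> (with_proj G) (\<lambda>_. 1) u v"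
proof -
  interpret pair_wf_digraph G by fact
  show ?thesis unfolding \<mu>_def
    by (rule INF_greatest) (use assms(2) in \<open>auto simp: awalk_def awalk_cost_def sum_list_triv\<close>)
qed

lemma vertex_list:
  assumes "pair_graph G"
  shows "distinct (vertex_list G)" "set (vertex_list G) = pverts G"
proof -
  interpret pair_graph G by fact
  have "\<exists>vs. distinct vs \<and> set vs = pverts G"
    using finite_distinct_list[OF pair_finite_verts] by blast
  from someI_ex[OF this] show "distinct (vertex_list G)" "set (vertex_list G) = pverts G"
    by (simp_all add: vertex_list_def)
qed

definition adj :: "'v pair_pre_digraph \<Rightarrow> 'v \<Rightarrow> 'v \<Rightarrow> real" where
  "adj G u v = (if (u, v) \<in> parcs G then 1 else 0)"

lemma adj_sym:
  assumes "pair_graph G"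
  shows "adj G u v = adj G v u"
proof -
  interpret pair_graph G by fact
  show ?thesis using arcs_symmetric by (auto simp: adj_def)
qed

lemma adjacency_matrix_adj:
  "adjacency_matrix G = mat (length (vertex_list G)) (length (vertex_list G))
     (\<lambda>(i, j). adj G (vertex_list G ! i) (vertex_list G ! j))"
  by (simp add: adjacency_matrix_def Let_def adj_def)

lemma degree_matrix_regular:
  assumes "pair_graph G" "regular_graph d G"
  shows "degree_matrix G = real d \<cdot>\<^sub>m 1\<^sub>m (length (vertex_list G))"
  using assms(2) vertex_list(2)[OF assms(1)]
  by (intro eq_matI) (auto simp: degree_matrix_def Let_def regular_graph_def dest: nth_mem)

lemma laplacian_matrix_regular:
  assumes "pair_graph G" "regular_graph d G"
  shows "laplacian_matrix G = mat (length (vertex_list G)) (length (vertex_list G))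
     (\<lambda>(i, j). (\<lambda>u v. (if u = v then real d else 0) - adj G u v) (vertex_list G ! i) (vertex_list G ! j))"
  unfolding laplacian_matrix_def degree_matrix_regular[OF assms]
  using vertex_list(1)[OF assms(1)]
  by (intro eq_matI) (auto simp: adjacency_matrix_adj nth_eq_iff_index_eq)

lemma card_neighbours:
  assumes "regular_graph d G" "u \<in> pverts G"
  shows "card {w. (u, w) \<in> parcs G} = d"
proof -
  have "out_arcs (with_proj G) u = Pair u ` {w. (u, w) \<in> parcs G}" by (auto simp: out_arcs_def)
  then have "out_degree (with_proj G) u = card {w. (u, w) \<in> parcs G}"
    unfolding out_degree_def by (simp add: card_image inj_on_def)
  then show ?thesis using assms by (simp add: regular_graph_def)
qed

text \<open>
  The eigenfunction of the star \<open>K\<^bsub>1,d\<^esub>\<close> for its largest eigenvalue \<open>sqrt d\<close>, extended by \<open>0\<close>.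
\<close>

definition star_function :: "'v pair_pre_digraph \<Rightarrow> 'v \<Rightarrow> 'v \<Rightarrow> real" where
  "star_function G u w = (if w = u then sqrt (card {w. (u, w) \<in> parcs G})
     else if (u, w) \<in> parcs G then 1 else 0)"

text \<open>
  Being nonnegative, the star function \<open>f\<close> satisfies \<open>A f \<ge> sqrt d \<cdot> f\<close> pointwise: edges outside the
  star can only increase the left-hand side.
\<close>

lemma star_function_Rayleigh:
  fixes G :: "'v pair_pre_digraph"
  assumes G: "pair_graph G" and reg: "regular_graph d G" and u: "u \<in> pverts G"
  defines "f \<equiv> star_function G u" and "V \<equiv> pverts G"
  shows "(\<Sum>x\<in>V. \<Sum>y\<in>V. f x * ((if x = y then real d else 0) - adj G x y) * f y)
    \<le> (d - sqrt d) * (\<Sum>x\<in>V. (f x)\<^sup>2)"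
proof -
  interpret pair_graph G by fact
  have V: "finite V" using pair_finite_verts by (simp add: V_def)
  define N where "N = {w. (u, w) \<in> parcs G}"
  have N: "card N = d" "N \<subseteq> V" "u \<notin> N"
    using card_neighbours[OF reg u] in_arcsD2 pair_no_loops[of "(u, u)"]
    by (auto simp: N_def V_def)
  have f: "f w = (if w = u then sqrt d else if w \<in> N then 1 else 0)" for w
    using card_neighbours[OF reg u] by (simp add: f_def star_function_def N_def)
  have f0: "f w \<ge> 0" for w by (simp add: f)
  have ge: "sqrt d * f x \<le> (\<Sum>y\<in>V. adj G x y * f y)" if "x \<in> V" for x
  proof -
    have nonneg: "0 \<le> adj G x y * f y" for y using f0 by (simp add: adj_def)
    consider "x = u" | "x \<in> N" "x \<noteq> u" | "x \<notin> N" "x \<noteq> u" by blast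
    then show ?thesis
    proof cases
      case 1
      have "sqrt d * f x = (\<Sum>y\<in>N. 1)" using 1 N by (simp add: f)
      also have "\<dots> = (\<Sum>y\<in>N. adj G x y * f y)"
        by (rule sum.cong) (use 1 N in \<open>auto simp: f adj_def N_def\<close>)
      also have "\<dots> \<le> (\<Sum>y\<in>V. adj G x y * f y)"
        by (rule sum_mono2) (use V N nonneg in auto)
      finally show ?thesis .
    next
      case 2
      then have "(x, u) \<in> parcs G" using arcs_symmetric by (auto simp: N_def)
      then have "sqrt d * f x = (\<Sum>y\<in>{u}. adj G x y * f y)" using 2 by (simp add: f adj_def)
      also have "\<dots> \<le> (\<Sum>y\<in>V. adj G x y * f y)"
        by (rule sum_mono2) (use V u nonneg in \<open>auto simp: V_def\<close>)
      finally show ?thesis .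
    next
      case 3
      then show ?thesis using nonneg by (simp add: f sum_nonneg)
    qed
  qed
  have "(\<Sum>x\<in>V. \<Sum>y\<in>V. f x * ((if x = y then real d else 0) - adj G x y) * f y)
      = (\<Sum>x\<in>V. d * (f x)\<^sup>2 - f x * (\<Sum>y\<in>V. adj G x y * f y))"
  proof (rule sum.cong)
    fix x assume "x \<in> V"
    have "(\<Sum>y\<in>V. f x * ((if x = y then real d else 0) - adj G x y) * f y)
        = (\<Sum>y\<in>V. (if y = x then d * (f x)\<^sup>2 else 0) - f x * (adj G x y * f y))"
      by (rule sum.cong) (auto simp: power2_eq_square algebra_simps)
    then show "(\<Sum>y\<in>V. f x * ((if x = y then real d else 0) - adj G x y) * f y)
        = d * (f x)\<^sup>2 - f x * (\<Sum>y\<in>V. adj G x y * f y)"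
      using V \<open>x \<in> V\<close> by (simp add: sum_subtractf sum_distrib_left)
  qed simp
  also have "\<dots> \<le> (\<Sum>x\<in>V. d * (f x)\<^sup>2 - f x * (sqrt d * f x))"
    using ge f0 by (intro sum_mono diff_mono mult_left_mono) auto
  also have "\<dots> = (d - sqrt d) * (\<Sum>x\<in>V. (f x)\<^sup>2)"
    by (simp add: sum_distrib_left power2_eq_square algebra_simps)
  finally show ?thesis .
qed

text \<open>
  Distance greater than \<open>3\<close> means that the closed neighbourhoods of \<open>u\<close> and \<open>v\<close> are disjoint and
  joined by no edge, so that the two star functions do not interact.
\<close>

lemma algebraic_connectivity_le_if_far_apart:
  fixes G :: "'v pair_pre_digraph"
  assumes G: "pair_graph G" and reg: "regular_graph d G" and d: "0 < d"
    and u: "u \<in> pverts G" and v: "v \<in> pverts G"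
    and far: "3 < wf_digraph.\<mu> (with_proj G) (\<lambda>_. 1) u v"
  shows "algebraic_connectivity G \<le> d - sqrt d"
proof -
  interpret pair_graph G by fact
  let ?V = "pverts G" and ?L = "\<lambda>x y. (if x = y then real d else 0) - adj G x y"
  have no_walk: False if "set p \<subseteq> parcs G" "pcas u p v" "length p \<le> 3" for p
  proof -
    have "pair_wf_digraph G" by unfold_locales
    from mu_le_length[OF this u that(1,2)] have "(3::ereal) < ereal (length p)"
      using far by (rule less_le_trans[rotated])
    then show False using that(3) by simp
  qed
  have no_edge: False if "x \<in> insert u {w. (u, w) \<in> parcs G}" "y \<in> insert v {w. (v, w) \<in> parcs G}"
    "x = y \<or> (x, y) \<in> parcs G" for x y
  proof -
    \<comment> \<open>A walk through \<open>x\<close> and \<open>y\<close> in which the steps that would be loops are left out.\<close>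
    define p where "p = (if x = u then [] else [(u, x)]) @ (if x = y then [] else [(x, y)])
      @ (if y = v then [] else [(y, v)])"
    have "set p \<subseteq> parcs G" using that arcs_symmetric by (auto simp: p_def)
    moreover have "pcas u p v" by (auto simp: p_def)
    moreover have "length p \<le> 3" by (auto simp: p_def)
    ultimately show False by (rule no_walk)
  qed
  let ?f = "star_function G u" and ?g = "star_function G v"
  have supp: "w \<in> insert x {w. (x, w) \<in> parcs G}" if "star_function G x w \<noteq> 0" for x w
    using that by (auto simp: star_function_def split: if_splits)
  have disj: "?f x * ?g x = 0" for x
    using no_edge[of x x] supp[of u x] supp[of v x] by fastforce
  have cross: "?f x * ?L x y * ?g y = 0" for x y
  proof (rule ccontr)
    assume "?f x * ?L x y * ?g y \<noteq> 0"
    then have "?f x \<noteq> 0" "?g y \<noteq> 0" "x = y \<or> (x, y) \<in> parcs G"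
      by (auto simp: adj_def split: if_splits)
    then show False using no_edge[OF supp supp] by blast
  qed
  have cross': "?g x * ?L x y * ?f y = 0" for x y
    using cross[of y x] adj_sym[OF G, of x y] by (cases "x = y") (auto simp: mult_ac)
  have pos: "0 < (\<Sum>y\<in>?V. (star_function G x y)\<^sup>2)" if "x \<in> ?V" for x
  proof (rule sum_pos2[OF pair_finite_verts that])
    show "0 < (star_function G x x)\<^sup>2"
      using card_neighbours[OF reg that] d by (simp add: star_function_def)
  qed simp
  define es where "es = sorted_list_of_multiset (spectrum_mset (laplacian_matrix G))"
  have mset_es: "mset es = spectrum_mset (laplacian_matrix G)" by (simp add: es_def)
  have "\<exists>\<phi>. orthonormal_eigenfunctions (set (vertex_list G)) ?L es \<phi>"
    by (rule orthonormal_eigenfunctions_exist[OF vertex_list(1)[OF G]])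
      (use mset_es laplacian_matrix_regular[OF G reg] adj_sym[OF G] in auto)
  then obtain \<phi> where \<phi>: "orthonormal_eigenfunctions ?V ?L es \<phi>"
    unfolding vertex_list(2)[OF G] by blast
  have "sorted es" by (simp add: es_def)
  note R = star_function_Rayleigh[OF G reg]
  have "es ! 1 \<le> d - sqrt d"
    by (rule second_eigenvalue_le_two_test_functions[OF \<phi> pair_finite_verts \<open>sorted es\<close>
        R[OF u] pos[OF u] R[OF v] pos[OF v] disj cross cross'])
  then show ?thesis by (simp add: algebraic_connectivity_def es_def)
qed

lemma algebraic_connectivity_le_if_diameter_4:
  fixes G :: "'v pair_pre_digraph"
  assumes G: "pair_graph G" and reg: "regular_graph d G" and d: "0 < d"
    and diam: "graph_diameter G = 4"
  shows "algebraic_connectivity G \<le> d - sqrt d"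
proof -
  have "3 < graph_diameter G" using diam by simp
  then obtain u v where "u \<in> pverts G" "v \<in> pverts G"
    "3 < wf_digraph.\<mu> (with_proj G) (\<lambda>_. 1) u v"
    unfolding graph_diameter_def less_SUP_iff by blast
  then show ?thesis using algebraic_connectivity_le_if_far_apart[OF G reg d] by blast
qed

section \<open>Incidence between triples\<close>

lemma triplesE:
  assumes "t \<in> triples"
  obtains b c where "t = (1, b, c)" "b \<noteq> 0 \<or> c \<noteq> 0"
  using assms by (auto simp: triples_def)

lemma triples_iff: "(a, b, c) \<in> triples \<longleftrightarrow> a = 1 \<and> (b \<noteq> 0 \<or> c \<noteq> 0)"
  by (auto simp: triples_def)

lemma card_triples: "card (triples :: 'f::{field, finite} triple set) = (card (UNIV :: 'f set))\<^sup>2 - 1"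
proof -
  have "triples = (\<lambda>(b, c). (1 :: 'f, b, c)) ` (UNIV - {(0, 0)})"
    by (auto simp: triples_def)
  then have "card (triples :: 'f triple set)
      = card ((\<lambda>(b, c). (1 :: 'f, b, c)) ` (UNIV - {(0 :: 'f, 0 :: 'f)}))" by (rule arg_cong)
  also have "\<dots> = card (UNIV - {(0 :: 'f, 0 :: 'f)})"
    by (rule card_image) (auto simp: inj_on_def)
  finally show ?thesis
    by (simp add: card_Diff_subset power2_eq_square card_cartesian_product flip: UNIV_Times_UNIV)
qed

lemma dot_commute: "dot s t = dot t s"
  by (cases s; cases t) (simp add: mult.commute)

text \<open>
  Proportionality of \<open>(b, c)\<close> and \<open>(y, z)\<close>, as the vanishing of a determinant.
\<close>

fun parallel :: "'f::field triple \<Rightarrow> 'f triple \<Rightarrow> bool" where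
  "parallel (a, b, c) (x, y, z) \<longleftrightarrow> b * z = c * y"

lemma parallel_refl [simp]: "parallel t t"
  by (cases t) simp

lemma parallel_sym: "parallel s t \<longleftrightarrow> parallel t s"
  by (cases s; cases t) (auto simp: mult.commute)

lemma parallel_trans:
  assumes "t \<in> triples" "parallel s t" "parallel t r"
  shows "parallel s r"
proof -
  obtain y z where t: "t = (1, y, z)" "y \<noteq> 0 \<or> z \<noteq> 0" using assms(1) by (rule triplesE)
  obtain a b c where s: "s = (a, b, c)" by (cases s)
  obtain x y' z' where r: "r = (x, y', z')" by (cases r)
  have e: "b * z = c * y" "y * z' = z * y'" using assms s t r by auto
  have "y * (b * z') = b * (y * z')" by simp
  also have "\<dots> = (b * z) * y'" using e(2) by simp
  also have "\<dots> = y * (c * y')" using e(1) by simp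
  finally have y: "y * (b * z') = y * (c * y')" .
  have "z * (b * z') = (b * z) * z'" by simp
  also have "\<dots> = c * (y * z')" using e(1) by simp
  also have "\<dots> = z * (c * y')" using e(2) by simp
  finally have "z * (b * z') = z * (c * y')" .
  with y show ?thesis using t(2) s r by auto
qed

text \<open>
  The class of \<open>(1, b, c)\<close> consists of the triples \<open>(1, k b, k c)\<close> for nonzero \<open>k\<close>.
\<close>

lemma card_parallel:
  fixes t :: "'f::{field, finite} triple"
  assumes "t \<in> triples"
  shows "card {s \<in> triples. parallel t s} = card (UNIV :: 'f set) - 1"
proof -
  obtain b c where t: "t = (1, b, c)" "b \<noteq> 0 \<or> c \<noteq> 0" using assms by (rule triplesE)
  have "{s \<in> triples. parallel t s} = (\<lambda>k. (1, k * b, k * c)) ` (UNIV - {0})"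
  proof (intro Set.set_eqI iffI)
    fix s assume "s \<in> {s \<in> triples. parallel t s}"
    then obtain y z where s: "s = (1, y, z)" "y \<noteq> 0 \<or> z \<noteq> 0" "b * z = c * y"
      using t by (auto elim!: triplesE)
    show "s \<in> (\<lambda>k. (1, k * b, k * c)) ` (UNIV - {0})"
    proof (cases "b = 0")
      case True
      then show ?thesis using s t by (intro image_eqI[of _ _ "z / c"]) auto
    next
      case False
      then show ?thesis using s
        by (intro image_eqI[of _ _ "y / b"]) (auto simp: field_simps)
    qed
  qed (use t in \<open>auto simp: triples_iff\<close>)
  moreover have "inj_on (\<lambda>k. (1 :: 'f, k * b, k * c)) (UNIV - {0})"
    using t(2) by (auto simp: inj_on_def)
  ultimately have "card {s \<in> triples. parallel t s} = card (UNIV - {0 :: 'f})"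
    by (simp add: card_image)
  then show ?thesis by (simp add: card_Diff_subset)
qed

text \<open>
  The affine line \<open>b x + c y = - 1\<close> has \<open>d\<close> points, and none of them is the origin.
\<close>

lemma card_incident:
  fixes t :: "'f::{field, finite} triple"
  assumes "t \<in> triples"
  shows "card {p \<in> triples. dot t p = 0} = card (UNIV :: 'f set)"
proof -
  obtain b c where t: "t = (1, b, c)" "b \<noteq> 0 \<or> c \<noteq> 0" using assms by (rule triplesE)
  show ?thesis
  proof (cases "c = 0")
    case True
    have "{p \<in> triples. dot t p = 0} = (\<lambda>y. (1 :: 'f, - 1 / b, y)) ` UNIV"
    proof (intro Set.set_eqI iffI)
      fix p assume "p \<in> {p \<in> triples. dot t p = 0}"
      then obtain x y where p: "p = (1, x, y)" "1 + b * x = 0" using t True by (auto elim!: triplesE)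
      then have "b * x = - 1" by (simp add: eq_neg_iff_add_eq_0 add.commute)
      then show "p \<in> (\<lambda>y. (1 :: 'f, - 1 / b, y)) ` UNIV" using p t True by (auto simp: field_simps)
    qed (use t True in \<open>auto simp: triples_iff\<close>)
    then show ?thesis by (simp add: card_image inj_on_def)
  next
    case False
    have "{p \<in> triples. dot t p = 0} = (\<lambda>x. (1 :: 'f, x, - (1 + b * x) / c)) ` UNIV"
    proof (intro Set.set_eqI iffI)
      fix p assume "p \<in> {p \<in> triples. dot t p = 0}"
      then obtain x y where p: "p = (1, x, y)" "1 + b * x + c * y = 0" using t by (auto elim!: triplesE)
      then have "y * c = - (1 + b * x)" by (metis add.commute eq_neg_iff_add_eq_0 mult.commute)
      then have "y = - (1 + b * x) / c" using False by (metis nonzero_mult_div_cancel_right)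
      then show "p \<in> (\<lambda>x. (1 :: 'f, x, - (1 + b * x) / c)) ` UNIV" using p by auto
    next
      fix p assume "p \<in> (\<lambda>x. (1 :: 'f, x, - (1 + b * x) / c)) ` UNIV"
      then obtain x where p: "p = (1, x, - (1 + b * x) / c)" by auto
      have "c * (- (1 + b * x) / c) = - (1 + b * x)" using False by simp
      then have "dot t p = 0" using t p by simp
      moreover have "x \<noteq> 0 \<or> - (1 + b * x) / c \<noteq> 0" using False by auto
      ultimately show "p \<in> {p \<in> triples. dot t p = 0}" using p by (simp add: triples_iff)
    qed
    then show ?thesis by (simp add: card_image inj_on_def)
  qed
qed

lemma common_incident_parallel:
  assumes "dot (1, b, c) (1, x, y) = 0" "dot (1, b', c') (1, x, y) = 0" "b * c' = c * b'"
  shows "b = b' \<and> c = c'"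
proof -
  have e: "1 + b * x + c * y = 0" "1 + b' * x + c' * y = 0" using assms by auto
  have "c' - c = c' * (1 + b * x + c * y) - c * (1 + b' * x + c' * y) - x * (b * c' - c * b')"
    by (simp add: algebra_simps)
  then have "c' - c = 0" unfolding e assms(3) by simp
  have "b' - b = b' * (1 + b * x + c * y) - b * (1 + b' * x + c' * y) + y * (b * c' - c * b')"
    by (simp add: algebra_simps)
  then have "b' - b = 0" unfolding e assms(3) by simp
  then show ?thesis using \<open>c' - c = 0\<close> by simp
qed

text \<open>
  Cramer's rule for the pair of linear equations in \<open>x\<close> and \<open>y\<close>.
\<close>

lemma common_incident_unique:
  fixes b c b' c' :: "'f::field"
  assumes D: "b * c' \<noteq> c * b'"
  shows "dot (1, b, c) (1, x, y) = 0 \<and> dot (1, b', c') (1, x, y) = 0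
    \<longleftrightarrow> x = (c - c') / (b * c' - c * b') \<and> y = (b' - b) / (b * c' - c * b')"
proof -
  define \<Delta> where "\<Delta> = b * c' - c * b'"
  have D0: "\<Delta> \<noteq> 0" using D by (simp add: \<Delta>_def)
  have e: "1 + b * x + c * y = 0 \<and> 1 + b' * x + c' * y = 0 \<longleftrightarrow>
      \<Delta> * x - (c - c') = 0 \<and> \<Delta> * y - (b' - b) = 0"
  proof (intro iffI conjI; elim conjE)
    assume e: "1 + b * x + c * y = 0" "1 + b' * x + c' * y = 0"
    have "\<Delta> * x - (c - c') = c' * (1 + b * x + c * y) - c * (1 + b' * x + c' * y)"
      by (simp add: \<Delta>_def algebra_simps)
    then show "\<Delta> * x - (c - c') = 0" unfolding e by simp
    have "\<Delta> * y - (b' - b) = b * (1 + b' * x + c' * y) - b' * (1 + b * x + c * y)"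
      by (simp add: \<Delta>_def algebra_simps)
    then show "\<Delta> * y - (b' - b) = 0" unfolding e by simp
  next
    assume e: "\<Delta> * x - (c - c') = 0" "\<Delta> * y - (b' - b) = 0"
    have "\<Delta> * (1 + b * x + c * y) = b * (\<Delta> * x - (c - c')) + c * (\<Delta> * y - (b' - b))"
      by (simp add: \<Delta>_def algebra_simps)
    then show "1 + b * x + c * y = 0" unfolding e using D0 by simp
    have "\<Delta> * (1 + b' * x + c' * y) = b' * (\<Delta> * x - (c - c')) + c' * (\<Delta> * y - (b' - b))"
      by (simp add: \<Delta>_def algebra_simps)
    then show "1 + b' * x + c' * y = 0" unfolding e using D0 by simp
  qed
  also have "\<dots> \<longleftrightarrow> x = (c - c') / \<Delta> \<and> y = (b' - b) / \<Delta>"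
    using D0 by (simp add: nonzero_eq_divide_eq mult.commute)
  finally show ?thesis by (simp add: \<Delta>_def)
qed

lemma card_common_incident:
  fixes s t :: "'f::{field, finite} triple"
  assumes "s \<in> triples" "t \<in> triples"
  shows "card {p \<in> triples. dot s p = 0 \<and> dot t p = 0}
    = (if s = t then card (UNIV :: 'f set) else if parallel s t then 0 else 1)"
proof -
  obtain b c where s: "s = (1, b, c)" using assms(1) by (auto elim: triplesE)
  obtain b' c' where t: "t = (1, b', c')" using assms(2) by (auto elim: triplesE)
  consider "s = t" | "s \<noteq> t" "parallel s t" | "\<not> parallel s t" by blast
  then show ?thesis
  proof cases
    case 1
    then show ?thesis using card_incident[OF assms(1)] by simp
  next
    case 2
    then have "{p \<in> triples. dot s p = 0 \<and> dot t p = 0} = {}"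
      using common_incident_parallel[of b c _ _ b' c'] s t by (auto elim!: triplesE simp del: dot.simps)
    then show ?thesis using 2 by (simp only: card.empty if_False if_True)
  next
    case 3
    then have D: "b * c' \<noteq> c * b'" using s t by simp
    let ?q = "(1, (c - c') / (b * c' - c * b'), (b' - b) / (b * c' - c * b'))"
    have q: "?q \<in> triples" using D by (auto simp: triples_iff)
    have "dot s p = 0 \<and> dot t p = 0 \<longleftrightarrow> p = ?q" if p: "p \<in> triples" for p
    proof -
      obtain x y where "p = (1, x, y)" using p by (auto elim: triplesE)
      then show ?thesis using common_incident_unique[OF D, of x y] by (simp add: s t del: dot.simps)
    qed
    then have "{p \<in> triples. dot s p = 0 \<and> dot t p = 0} = {?q}" using q by blast
    moreover have "s \<noteq> t" using 3 by auto
    ultimately show ?thesis using 3 by simp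
  qed
qed

definition incidence :: "'f::field triple \<Rightarrow> 'f triple \<Rightarrow> real" where
  "incidence s t = (if dot s t = 0 then 1 else 0)"

text \<open>
  The entries of \<open>d I + J - K\<close>, with \<open>J\<close> the all-ones matrix and \<open>K\<close> the indicator matrix of
  parallelism. The value is \<open>d\<close> on the diagonal, \<open>0\<close> at the other parallel pairs, and \<open>1\<close> elsewhere.
\<close>

definition common_neighbours :: "'f::{field, finite} triple \<Rightarrow> 'f triple \<Rightarrow> real" where
  "common_neighbours s t =
     (if s = t then real (card (UNIV :: 'f set)) else 0) + 1 - (if parallel s t then 1 else 0)"

lemma incidence_square:
  fixes s t :: "'f::{field, finite} triple"
  assumes "s \<in> triples" "t \<in> triples"
  shows "(\<Sum>p\<in>triples. incidence s p * incidence p t)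
    = common_neighbours s t"
proof -
  have "(\<Sum>p\<in>triples. incidence s p * incidence p t)
      = (\<Sum>p\<in>triples. if dot s p = 0 \<and> dot t p = 0 then 1 else 0)"
    by (rule sum.cong) (auto simp: incidence_def dot_commute[of _ t])
  also have "\<dots> = real (card {p \<in> triples. dot s p = 0 \<and> dot t p = 0})"
    by (simp add: sum.If_cases Int_def)
  finally show ?thesis using card_common_incident[OF assms] by (auto simp: common_neighbours_def)
qed

text \<open>
  With \<open>S\<close> the sum of \<open>g\<close> and \<open>C s\<close> its sum over the parallel class of \<open>s\<close>, the eigenvalue equation
  reads \<open>(\<mu> - d) g s = S - C s\<close>. Summing over everything gives \<open>(\<mu> - d\<^sup>2) S = 0\<close> and summing over a
  class gives \<open>(\<mu> - 1) C s = (d - 1) S\<close>. Unless \<open>\<mu>\<close> is one of the three values, \<open>S\<close>, then \<open>C\<close> and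
  then \<open>g\<close> vanish.
\<close>

lemma incidence_square_eigenvalue:
  fixes g :: "'f::{field, finite} triple \<Rightarrow> real"
  defines "d \<equiv> real (card (UNIV :: 'f set))"
  assumes ev: "\<And>s. s \<in> triples \<Longrightarrow> 
      (\<Sum>t\<in>triples. common_neighbours s t * g t) = \<mu> * g s"
    and nz: "t\<^sub>0 \<in> triples" "g t\<^sub>0 \<noteq> 0"
  shows "\<mu> = d\<^sup>2 \<or> \<mu> = d \<or> \<mu> = 1"
proof -
  define S where "S = (\<Sum>t\<in>triples. g t)"
  define C where "C s = (\<Sum>t | t \<in> triples \<and> parallel s t. g t)" for s
  have d1: "d \<ge> 1" by (simp add: d_def Suc_le_eq finite_UNIV_card_ge_0)
  have card_T: "real (card (triples :: 'f triple set)) = d\<^sup>2 - 1"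
    using d1 by (simp add: card_triples d_def of_nat_diff)
  have card_C: "real (card {t \<in> triples. parallel s t}) = d - 1" if "s \<in> triples" for s :: "'f triple"
    using d1 card_parallel[OF that] by (simp add: d_def of_nat_diff)
  have eq: "(\<mu> - d) * g s = S - C s" if "s \<in> triples" for s
  proof -
    have "(\<Sum>t\<in>triples. common_neighbours s t * g t)
        = (\<Sum>t\<in>triples. (if t = s then d * g s else 0) + g t - (if parallel s t then g t else 0))"
      by (rule sum.cong) (auto simp: common_neighbours_def d_def algebra_simps)
    also have "\<dots> = d * g s + S - C s"
      using that by (simp add: sum.distrib sum_subtractf S_def C_def sum.If_cases Int_def)
    finally show ?thesis using ev[OF that] by (simp add: algebra_simps)
  qed
  have C_eq: "C t = C s" if "s \<in> triples" "t \<in> triples" "parallel s t" for s t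
  proof -
    have "{r \<in> triples. parallel t r} = {r \<in> triples. parallel s r}"
      using that parallel_trans[of t s] parallel_trans[of s t] parallel_sym[of s t] by blast
    then show ?thesis by (simp add: C_def)
  qed
  have C: "(\<mu> - 1) * C s = (d - 1) * S" if "s \<in> triples" for s
  proof -
    have "(\<mu> - d) * C s = (\<Sum>t | t \<in> triples \<and> parallel s t. S - C s)"
      unfolding C_def[of s] sum_distrib_left
      by (rule sum.cong) (use eq C_eq[OF that] in \<open>auto simp: C_def\<close>)
    also have "\<dots> = (d - 1) * (S - C s)" using card_C[OF that] by simp
    finally show ?thesis by (simp add: algebra_simps)
  qed
  have sum_C: "(\<Sum>s\<in>triples. C s) = (d - 1) * S"
  proof -
    have "(\<Sum>s\<in>triples. C s) = (\<Sum>s\<in>triples. \<Sum>t\<in>triples. if parallel s t then g t else 0)"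
      by (simp add: C_def sum.If_cases Int_def)
    also have "\<dots> = (\<Sum>t\<in>triples. \<Sum>s\<in>triples. if parallel t s then g t else 0)"
      by (subst sum.swap) (simp add: parallel_sym)
    also have "\<dots> = (\<Sum>t\<in>triples. (d - 1) * g t)"
      by (rule sum.cong) (simp_all add: sum.If_cases Int_def card_C)
    finally show ?thesis by (simp add: S_def sum_distrib_left)
  qed
  have "(\<mu> - d) * S = (\<Sum>s\<in>triples. (\<mu> - d) * g s)"
    by (simp add: S_def sum_distrib_left)
  also have "\<dots> = (\<Sum>s\<in>triples. S - C s)" by (simp add: eq)
  also have "\<dots> = (d\<^sup>2 - 1) * S - (d - 1) * S"
    by (simp add: sum_subtractf sum_C card_T)
  finally have S: "(\<mu> - d\<^sup>2) * S = 0" by (simp add: algebra_simps)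
  show ?thesis
  proof (rule ccontr)
    assume "\<not> ?thesis"
    then have ne: "\<mu> \<noteq> d\<^sup>2" "\<mu> \<noteq> d" "\<mu> \<noteq> 1" by auto
    have "S = 0" using S ne by simp
    then have "C t\<^sub>0 = 0" using C[OF nz(1)] ne by simp
    then have "g t\<^sub>0 = 0" using eq[OF nz(1)] \<open>S = 0\<close> ne by simp
    then show False using nz by simp
  qed
qed

section \<open>Multiplicities from the moments of the spectrum\<close>

lemma orthonormal_eigenfunctions_mult:
  assumes "orthonormal_eigenfunctions V a es \<phi>"
  shows "(\<Sum>v\<in>V. (\<Sum>i<length es. x i * \<phi> i u * \<phi> i v) * (\<Sum>j<length es. y j * \<phi> j v * \<phi> j w))
    = (\<Sum>i<length es. x i * y i * \<phi> i u * \<phi> i w)"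
proof -
  let ?n = "length es"
  have "(\<Sum>v\<in>V. (\<Sum>i<?n. x i * \<phi> i u * \<phi> i v) * (\<Sum>j<?n. y j * \<phi> j v * \<phi> j w))
      = (\<Sum>v\<in>V. \<Sum>i<?n. \<Sum>j<?n. x i * \<phi> i u * (y j * \<phi> j w) * (\<phi> i v * \<phi> j v))"
    by (simp add: sum_product mult_ac)
  also have "\<dots> = (\<Sum>i<?n. \<Sum>v\<in>V. \<Sum>j<?n. x i * \<phi> i u * (y j * \<phi> j w) * (\<phi> i v * \<phi> j v))"
    by (rule sum.swap)
  also have "\<dots> = (\<Sum>i<?n. \<Sum>j<?n. \<Sum>v\<in>V. x i * \<phi> i u * (y j * \<phi> j w) * (\<phi> i v * \<phi> j v))"
    by (intro sum.cong refl sum.swap)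
  also have "\<dots> = (\<Sum>i<?n. \<Sum>j<?n. if j = i then x i * y i * \<phi> i u * \<phi> i w else 0)"
    by (intro sum.cong refl)
      (use assms in \<open>auto simp: orthonormal_eigenfunctions_def simp flip: sum_distrib_left\<close>)
  finally show ?thesis by simp
qed

text \<open>
  The entries of the \<open>k\<close>-th power of the matrix whose spectral decomposition is given by \<open>es\<close> and \<open>\<phi>\<close>.
\<close>

definition spectral_power :: "real list \<Rightarrow> (nat \<Rightarrow> 'v \<Rightarrow> real) \<Rightarrow> nat \<Rightarrow> 'v \<Rightarrow> 'v \<Rightarrow> real" where
  "spectral_power es \<phi> k u v = (\<Sum>i<length es. es ! i ^ k * \<phi> i u * \<phi> i v)"

lemma spectral_power_add:
  assumes "orthonormal_eigenfunctions V a es \<phi>"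
  shows "spectral_power es \<phi> (j + k) u w
    = (\<Sum>v\<in>V. spectral_power es \<phi> j u v * spectral_power es \<phi> k v w)"
  unfolding spectral_power_def orthonormal_eigenfunctions_mult[OF assms] by (simp add: power_add)

lemma spectral_power_simps:
  assumes "orthonormal_eigenfunctions V a es \<phi>" "u \<in> V" "v \<in> V"
  shows "spectral_power es \<phi> 0 u v = (if u = v then 1 else 0)"
    and "spectral_power es \<phi> (Suc 0) u v = a u v"
  using assms by (simp_all add: spectral_power_def orthonormal_eigenfunctions_def)

lemma spectral_power_2:
  assumes "orthonormal_eigenfunctions V a es \<phi>" "u \<in> V" "w \<in> V"
  shows "spectral_power es \<phi> 2 u w = (\<Sum>v\<in>V. a u v * a v w)"
proof -
  have "spectral_power es \<phi> (Suc 0 + Suc 0) u w = (\<Sum>v\<in>V. a u v * a v w)"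
    unfolding spectral_power_add[OF assms(1)]
    by (rule sum.cong) (use assms in \<open>simp_all add: spectral_power_simps[OF assms(1)]\<close>)
  then show ?thesis by (simp add: numeral_2_eq_2)
qed

lemma trace_spectral_power:
  assumes "orthonormal_eigenfunctions V a es \<phi>"
  shows "(\<Sum>v\<in>V. spectral_power es \<phi> k v v) = (\<Sum>e\<leftarrow>es. e ^ k)"
proof -
  have "(\<Sum>v\<in>V. spectral_power es \<phi> k v v) = (\<Sum>i<length es. \<Sum>v\<in>V. es ! i ^ k * (\<phi> i v * \<phi> i v))"
    unfolding spectral_power_def by (subst sum.swap) (simp add: mult.assoc)
  also have "\<dots> = (\<Sum>i<length es. es ! i ^ k)"
    by (rule sum.cong)
      (use assms in \<open>auto simp: orthonormal_eigenfunctions_def simp flip: sum_distrib_left\<close>)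
  finally show ?thesis by (simp add: sum_list_sum_nth lessThan_atLeast0)
qed

lemma eigenfunction_of_orthonormal:
  assumes \<phi>: "orthonormal_eigenfunctions V a es \<phi>" and "finite V" "i < length es" "u \<in> V"
  shows "(\<Sum>v\<in>V. spectral_power es \<phi> k u v * \<phi> i v) = es ! i ^ k * \<phi> i u"
proof -
  have "(\<Sum>v\<in>V. spectral_power es \<phi> k u v * \<phi> i v)
      = (\<Sum>j<length es. \<Sum>v\<in>V. es ! j ^ k * \<phi> j u * (\<phi> j v * \<phi> i v))"
    unfolding spectral_power_def sum_distrib_right by (subst sum.swap) (simp add: mult.assoc)
  also have "\<dots> = (\<Sum>j<length es. if j = i then es ! i ^ k * \<phi> i u else 0)"
    by (rule sum.cong)
      (use assms in \<open>auto simp: orthonormal_eigenfunctions_def simp flip: sum_distrib_left\<close>)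
  finally show ?thesis using \<open>i < length es\<close> by simp
qed

text \<open>
  Conjugation with the diagonal sign matrix \<open>s\<close> of a bipartition negates the matrix, so it multiplies
  the \<open>k\<close>-th power by \<open>(- 1)^k\<close>. On the diagonal this makes every odd power vanish.
\<close>

lemma bipartite_spectral_power:
  assumes \<phi>: "orthonormal_eigenfunctions V a es \<phi>"
    and s: "\<And>v. v \<in> V \<Longrightarrow> s v * s v = (1::real)"
    and bip: "\<And>u v. u \<in> V \<Longrightarrow> v \<in> V \<Longrightarrow> s u * a u v * s v = - a u v"
    and "u \<in> V" "w \<in> V"
  shows "s u * spectral_power es \<phi> k u w * s w = (- 1) ^ k * spectral_power es \<phi> k u w"
  using \<open>u \<in> V\<close>
proof (induction k arbitrary: u)
  case 0
  then show ?case using s \<open>w \<in> V\<close> by (simp add: spectral_power_simps[OF \<phi>])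
next
  case (Suc k)
  have step: "spectral_power es \<phi> (Suc k) u w = (\<Sum>v\<in>V. a u v * spectral_power es \<phi> k v w)"
    if "u \<in> V" for u
    unfolding spectral_power_add[OF \<phi>, of "Suc 0" k, simplified]
    by (rule sum.cong) (use that in \<open>simp_all add: spectral_power_simps[OF \<phi>]\<close>)
  have "s u * spectral_power es \<phi> (Suc k) u w * s w
      = (\<Sum>v\<in>V. (s u * a u v * s v) * (s v * spectral_power es \<phi> k v w * s w))"
    unfolding step[OF Suc.prems] sum_distrib_left sum_distrib_right
  proof (rule sum.cong)
    fix v assume "v \<in> V"
    have "(s u * a u v * s v) * (s v * spectral_power es \<phi> k v w * s w)
        = s u * (a u v * spectral_power es \<phi> k v w) * s w * (s v * s v)" by (simp add: mult_ac)
    then show "s u * (a u v * spectral_power es \<phi> k v w) * s w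
        = (s u * a u v * s v) * (s v * spectral_power es \<phi> k v w * s w)"
      using s[OF \<open>v \<in> V\<close>] by simp
  qed simp
  also have "\<dots> = (\<Sum>v\<in>V. (- 1) ^ Suc k * (a u v * spectral_power es \<phi> k v w))"
    by (rule sum.cong) (use bip Suc in auto)
  finally show ?case unfolding step[OF Suc.prems] by (simp add: sum_distrib_left)
qed

lemma bipartite_odd_moment:
  fixes s :: "'v \<Rightarrow> real"
  assumes \<phi>: "orthonormal_eigenfunctions V a es \<phi>"
    and s: "\<And>v. v \<in> V \<Longrightarrow> s v * s v = 1"
    and bip: "\<And>u v. u \<in> V \<Longrightarrow> v \<in> V \<Longrightarrow> s u * a u v * s v = - a u v"
    and "odd k"
  shows "(\<Sum>e\<leftarrow>es. e ^ k) = 0"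
proof -
  have "spectral_power es \<phi> k v v = 0" if v: "v \<in> V" for v
  proof -
    have "s v * spectral_power es \<phi> k v v * s v = spectral_power es \<phi> k v v * (s v * s v)"
      by (simp add: mult_ac)
    then show ?thesis
      using bipartite_spectral_power[OF \<phi> s bip v v, of k] s[OF v] \<open>odd k\<close> by simp
  qed
  then show ?thesis using trace_spectral_power[OF \<phi>, of k] by simp
qed

lemma sum_list_count:
  fixes f :: "'a \<Rightarrow> real"
  assumes "finite S" "set es \<subseteq> S"
  shows "(\<Sum>e\<leftarrow>es. f e) = (\<Sum>x\<in>S. real (count (mset es) x) * f x)"
  using assms(2)
proof (induction es)
  case (Cons e es)
  have "(\<Sum>x\<in>S. real (count (mset (e # es)) x) * f x)
      = (\<Sum>x\<in>S. (if x = e then f e else 0) + real (count (mset es) x) * f x)"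
    by (rule sum.cong) (auto simp: algebra_simps)
  then show ?case using Cons assms(1) by (simp add: sum.distrib)
qed simp

text \<open>
  Here \<open>s = sqrt d\<close>, the numbers \<open>c1, \<dots>, c6\<close> are the multiplicities of \<open>d, -d, s, -s, 1, -1\<close>, and
  \<open>M k\<close> is the trace of the \<open>k\<close>-th power. The odd equations involve only the differences of
  multiplicities of opposite eigenvalues, the even ones only their sums. Each is a Vandermonde system of
  size three, solved by elimination.
\<close>

lemma moment_equations:
  fixes d s c1 c2 c3 c4 c5 c6 :: real
  assumes s: "s > 1" and d: "d = s\<^sup>2"
    and m: "\<And>k. M k = c1 * d ^ k + c2 * (- d) ^ k + c3 * s ^ k + c4 * (- s) ^ k
      + c5 * 1 ^ k + c6 * (- 1) ^ k"
    and M: "M 0 = 2 * (d\<^sup>2 - 1)" "M 1 = 0" "M 2 = 2 * (d * (d\<^sup>2 - 1))" "M 3 = 0"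
      "M 4 = 2 * ((d\<^sup>2 - 1) * (2 * d\<^sup>2 - d))" "M 5 = 0"
  shows "c1 = 1 \<and> c2 = 1 \<and> c3 = d\<^sup>2 - d - 2 \<and> c4 = d\<^sup>2 - d - 2 \<and> c5 = d \<and> c6 = d"
proof -
  have d1: "d > 1" using s d by (simp add: power2_eq_square less_1_mult)
  define e1 where "e1 = c1 - c2"
  define e2 where "e2 = c3 - c4"
  define e3 where "e3 = c5 - c6"
  \<comment> \<open>Eliminating \<open>e3\<close> and then \<open>e2\<close> leaves \<open>e1\<close> with a coefficient that is positive because \<open>s > 1\<close>.\<close>
  have o1: "s ^ 2 * e1 + s * e2 + e3 = 0" using M(2) unfolding m d e1_def e2_def e3_def
    by (simp add: algebra_simps)
  have o3: "s ^ 6 * e1 + s ^ 3 * e2 + e3 = 0" using M(4) unfolding m d e1_def e2_def e3_def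
    by (simp add: algebra_simps flip: power_mult)
  have o5: "s ^ 10 * e1 + s ^ 5 * e2 + e3 = 0" using M(6) unfolding m d e1_def e2_def e3_def
    by (simp add: algebra_simps flip: power_mult)
  have s2: "s\<^sup>2 - 1 > 0" using s by (simp add: power2_eq_square less_1_mult)
  have "(s * (s\<^sup>2 - 1)) * (s * (s\<^sup>2 + 1) * e1 + e2)
      = (s ^ 6 * e1 + s ^ 3 * e2 + e3) - (s ^ 2 * e1 + s * e2 + e3)"
    by (simp add: algebra_simps power_numeral_reduce)
  then have p1: "s * (s\<^sup>2 + 1) * e1 + e2 = 0" using o1 o3 s s2 by simp
  have "(s ^ 3 * (s\<^sup>2 - 1)) * (s ^ 3 * (s\<^sup>2 + 1) * e1 + e2)
      = (s ^ 10 * e1 + s ^ 5 * e2 + e3) - (s ^ 6 * e1 + s ^ 3 * e2 + e3)"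
    by (simp add: algebra_simps power_numeral_reduce)
  then have p2: "s ^ 3 * (s\<^sup>2 + 1) * e1 + e2 = 0" using o5 o3 s s2 by simp
  have "(s * (s\<^sup>2 - 1) * (s\<^sup>2 + 1)) * e1
      = (s ^ 3 * (s\<^sup>2 + 1) * e1 + e2) - (s * (s\<^sup>2 + 1) * e1 + e2)"
    by (simp add: algebra_simps power_numeral_reduce)
  then have "(s * (s\<^sup>2 - 1) * (s\<^sup>2 + 1)) * e1 = 0" unfolding p1 p2 by simp
  moreover have "s * (s\<^sup>2 - 1) * (s\<^sup>2 + 1) > 0" using s s2 by (simp add: add_pos_pos)
  ultimately have e1: "e1 = 0" by (metis less_irrefl mult_eq_0_iff)
  have e2: "e2 = 0" using p1 e1 by simp
  have e3: "e3 = 0" using o1 e1 e2 by simp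
  define m1 where "m1 = c1 + c2"
  define m2 where "m2 = c3 + c4"
  define m3 where "m3 = c5 + c6"
  have q0: "m1 + m2 + m3 = 2 * (d\<^sup>2 - 1)" using M(1) unfolding m m1_def m2_def m3_def by simp
  have q2: "d ^ 2 * m1 + d * m2 + m3 = 2 * (d * (d\<^sup>2 - 1))"
    using M(3) unfolding m m1_def m2_def m3_def by (simp add: d algebra_simps)
  have s4: "s ^ 4 = d\<^sup>2" by (simp add: d flip: power_mult)
  have q4: "d ^ 4 * m1 + d ^ 2 * m2 + m3 = 2 * ((d\<^sup>2 - 1) * (2 * d\<^sup>2 - d))"
    using M(5) unfolding m m1_def m2_def m3_def by (simp add: s4 algebra_simps)
  have "(d - 1) * ((d + 1) * m1 + m2 - 2 * (d\<^sup>2 - 1))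
      = (d ^ 2 * m1 + d * m2 + m3 - 2 * (d * (d\<^sup>2 - 1))) - (m1 + m2 + m3 - 2 * (d\<^sup>2 - 1))"
    by (simp add: algebra_simps power_numeral_reduce)
  then have r1: "(d + 1) * m1 + m2 - 2 * (d\<^sup>2 - 1) = 0" using q0 q2 d1 by simp
  have "(d\<^sup>2 - 1) * ((d\<^sup>2 + 1) * m1 + m2 - 2 * (2 * d\<^sup>2 - d - 1))
      = (d ^ 4 * m1 + d ^ 2 * m2 + m3 - 2 * ((d\<^sup>2 - 1) * (2 * d\<^sup>2 - d)))
        - (m1 + m2 + m3 - 2 * (d\<^sup>2 - 1))"
    by (simp add: algebra_simps power_numeral_reduce)
  moreover have "d\<^sup>2 - 1 > 0" using d1 by (simp add: power2_eq_square less_1_mult)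
  ultimately have r2: "(d\<^sup>2 + 1) * m1 + m2 - 2 * (2 * d\<^sup>2 - d - 1) = 0" using q0 q4 by simp
  have "(d * (d - 1)) * (m1 - 2)
      = ((d\<^sup>2 + 1) * m1 + m2 - 2 * (2 * d\<^sup>2 - d - 1)) - ((d + 1) * m1 + m2 - 2 * (d\<^sup>2 - 1))"
    by (simp add: algebra_simps power_numeral_reduce)
  then have "(d * (d - 1)) * (m1 - 2) = 0" unfolding r1 r2 by simp
  then have m1: "m1 = 2" using d1 by simp
  have m2: "m2 = 2 * (d\<^sup>2 - d - 2)" using r1 m1 by (simp add: algebra_simps)
  have m3: "m3 = 2 * d" using q0 m1 m2 by (simp add: algebra_simps)
  show ?thesis using e1 e2 e3 m1 m2 m3
    unfolding e1_def e2_def e3_def m1_def m2_def m3_def by argo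
qed

section \<open>The spectrum of the line-point graph\<close>

lemma pverts_line_point_graph: "pverts line_point_graph = Line ` triples \<union> Point ` triples"
  by (simp add: line_point_graph_def)

lemma parcs_line_point_graph [simp]:
  "(Line l, Point p) \<in> parcs line_point_graph \<longleftrightarrow> l \<in> triples \<and> p \<in> triples \<and> dot l p = 0"
  "(Point p, Line l) \<in> parcs line_point_graph \<longleftrightarrow> l \<in> triples \<and> p \<in> triples \<and> dot l p = 0"
  "(Line l, Line l') \<notin> parcs line_point_graph"
  "(Point p, Point p') \<notin> parcs line_point_graph"
  by (auto simp: line_point_graph_def simp del: split_paired_Ex)

lemma pair_graph_line_point_graph:
  "pair_graph (line_point_graph :: 'f::{field, finite} vertex pair_pre_digraph)"
proof -
  let ?G = "line_point_graph :: 'f vertex pair_pre_digraph"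
  have V: "finite (pverts ?G)" by (simp add: pverts_line_point_graph)
  have sub: "parcs ?G \<subseteq> pverts ?G \<times> pverts ?G" by (auto simp: line_point_graph_def)
  have "symmetric (with_proj ?G)" by (auto simp: symmetric_def sym_def line_point_graph_def)
  then show ?thesis
    using V sub finite_subset[OF sub]
    by unfold_locales (auto simp: line_point_graph_def)
qed

lemma card_vertices_line_point_graph:
  "card (pverts (line_point_graph :: 'f::{field, finite} vertex pair_pre_digraph))
    = 2 * (card (UNIV :: 'f set))\<^sup>2 - 2"
proof -
  have "card (Line ` (triples :: 'f triple set) \<union> Point ` triples)
      = card (Line ` (triples :: 'f triple set)) + card (Point ` (triples :: 'f triple set))"
    by (rule card_Un_disjoint) auto
  then show ?thesis by (simp add: pverts_line_point_graph card_image inj_on_def card_triples)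
qed

lemma regular_line_point_graph:
  "regular_graph (card (UNIV :: 'f set)) (line_point_graph :: 'f::{field, finite} vertex pair_pre_digraph)"
  unfolding regular_graph_def
proof
  let ?G = "line_point_graph :: 'f vertex pair_pre_digraph"
  fix v assume v: "v \<in> pverts ?G"
  show "out_degree (with_proj ?G) v = card (UNIV :: 'f set)"
  proof (cases v)
    case (Line l)
    then have "l \<in> triples" using v by (auto simp: pverts_line_point_graph)
    moreover have "out_arcs (with_proj ?G) v = (\<lambda>p. (v, Point p)) ` {p \<in> triples. dot l p = 0}"
      using \<open>l \<in> triples\<close> Line
      by (auto simp: out_arcs_def line_point_graph_def simp del: split_paired_Ex)
    ultimately show ?thesis
      by (simp add: out_degree_def card_image inj_on_def card_incident)
  next
    case (Point p)
    then have "p \<in> triples" using v by (auto simp: pverts_line_point_graph)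
    moreover have "out_arcs (with_proj ?G) v = (\<lambda>l. (v, Line l)) ` {l \<in> triples. dot p l = 0}"
      using \<open>p \<in> triples\<close> Point
      by (auto simp: out_arcs_def line_point_graph_def dot_commute[of _ p] simp del: split_paired_Ex)
    ultimately show ?thesis
      by (simp add: out_degree_def card_image inj_on_def card_incident)
  qed
qed

lemma sum_vertices:
  fixes f :: "'f::{field, finite} vertex \<Rightarrow> real"
  shows "sum f (pverts line_point_graph) = (\<Sum>t\<in>triples. f (Line t)) + (\<Sum>t\<in>triples. f (Point t))"
proof -
  have "sum f (Line ` triples \<union> Point ` triples) = sum f (Line ` triples) + sum f (Point ` triples)"
    by (rule sum.union_disjoint) auto
  then show ?thesis by (simp add: pverts_line_point_graph sum.reindex inj_on_def)
qed

lemma adj_line_point_graph [simp]: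
  "adj line_point_graph (Line l) (Line l') = 0"
  "adj line_point_graph (Point p) (Point p') = 0"
  "\<lbrakk>l \<in> triples; p \<in> triples\<rbrakk> \<Longrightarrow> adj line_point_graph (Line l) (Point p) = incidence l p"
  "\<lbrakk>l \<in> triples; p \<in> triples\<rbrakk> \<Longrightarrow> adj line_point_graph (Point p) (Line l) = incidence p l"
  by (auto simp: adj_def incidence_def dot_commute)

lemma adj_square_line_point_graph:
  fixes s t :: "'f::{field, finite} triple"
  assumes "s \<in> triples" "t \<in> triples"
  defines "G \<equiv> line_point_graph :: 'f vertex pair_pre_digraph"
  shows "(\<Sum>v\<in>pverts G. adj G (Line s) v * adj G v (Line t)) = common_neighbours s t"
    and "(\<Sum>v\<in>pverts G. adj G (Point s) v * adj G v (Point t)) = common_neighbours s t"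
    and "(\<Sum>v\<in>pverts G. adj G (Line s) v * adj G v (Point t)) = 0"
    and "(\<Sum>v\<in>pverts G. adj G (Point s) v * adj G v (Line t)) = 0"
  using assms(1,2) incidence_square[OF assms(1,2)]
  by (simp_all add: G_def sum_vertices)

text \<open>
  The row sum over the squared entries: \<open>d\<^sup>2\<close> from the diagonal, and \<open>1\<close> for each of the
  \<open>d\<^sup>2 - d\<close> triples that are not parallel to \<open>s\<close>.
\<close>

lemma sum_common_neighbours_squared:
  fixes s :: "'f::{field, finite} triple"
  assumes "s \<in> triples"
  defines "d \<equiv> real (card (UNIV :: 'f set))"
  shows "(\<Sum>t\<in>triples. (common_neighbours s t)\<^sup>2) = 2 * d\<^sup>2 - d"
proof -
  have d1: "card (UNIV :: 'f set) \<ge> 1" by (simp add: Suc_le_eq finite_UNIV_card_ge_0)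
  have "(\<Sum>t\<in>triples. (common_neighbours s t)\<^sup>2)
      = (\<Sum>t\<in>triples. (if t = s then d\<^sup>2 else 0) + 1 - (if parallel s t then 1 else 0))"
    by (rule sum.cong) (auto simp: common_neighbours_def d_def)
  also have "\<dots> = d\<^sup>2 + real (card (triples :: 'f triple set)) - real (card {t \<in> triples. parallel s t})"
    using assms(1) by (simp add: sum.distrib sum_subtractf sum.If_cases Int_def)
  also have "\<dots> = 2 * d\<^sup>2 - d"
    using d1 by (simp add: card_triples card_parallel[OF assms(1)] d_def of_nat_diff)
  finally show ?thesis .
qed

text \<open>
  The second moment counts ordered adjacent pairs, and the fourth is the sum of the squared entries of
  the squared adjacency matrix.
\<close>

theorem spectrum_line_point_graph:
  fixes G :: "'f::{field, finite} vertex pair_pre_digraph"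
  defines "d \<equiv> card (UNIV :: 'f set)" and "G \<equiv> line_point_graph"
  shows "spectrum_mset (adjacency_matrix G) =
    {# real d, - real d #}
    + replicate_mset (d\<^sup>2 - d - 2) (sqrt d) + replicate_mset (d\<^sup>2 - d - 2) (- sqrt d)
    + replicate_mset d 1 + replicate_mset d (- 1)"
proof -
  have G: "pair_graph G" unfolding G_def by (rule pair_graph_line_point_graph)
  let ?V = "pverts G" and ?a = "adj G" and ?T = "triples :: 'f triple set"
  have "card {0 :: 'f, 1} \<le> d" unfolding d_def by (rule card_mono) auto
  then have d2: "d \<ge> 2" by simp
  have V: "finite ?V" by (simp add: G_def pverts_line_point_graph)
  have V_sum: "sum f ?V = (\<Sum>t\<in>?T. f (Line t)) + (\<Sum>t\<in>?T. f (Point t))" for f :: "_ \<Rightarrow> real"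
    unfolding G_def by (rule sum_vertices)
  have V_cases: "(\<exists>t\<in>?T. v = Line t) \<or> (\<exists>t\<in>?T. v = Point t)" if "v \<in> ?V" for v
    using that by (auto simp: G_def pverts_line_point_graph)
  have Line: "Line t \<in> ?V" and Point: "Point t \<in> ?V" if "t \<in> ?T" for t
    using that by (auto simp: G_def pverts_line_point_graph)
  note sq = adj_square_line_point_graph[where 'f = 'f, folded G_def]
  obtain es where es: "mset es = spectrum_mset (adjacency_matrix G)" using ex_mset by blast
  have "\<exists>\<phi>. orthonormal_eigenfunctions (set (vertex_list G)) ?a es \<phi>"
    using es adj_sym[OF G] unfolding adjacency_matrix_adj
    by (intro orthonormal_eigenfunctions_exist[OF vertex_list(1)[OF G]]) auto
  then obtain \<phi> where \<phi>: "orthonormal_eigenfunctions ?V ?a es \<phi>"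
    unfolding vertex_list(2)[OF G] by blast
  let ?p = "spectral_power es \<phi>"
  have p2: "?p 2 (Line s) (Line t) = common_neighbours s t"
    "?p 2 (Point s) (Point t) = common_neighbours s t"
    "?p 2 (Line s) (Point t) = 0" "?p 2 (Point s) (Line t) = 0"
    if "s \<in> ?T" "t \<in> ?T" for s t
    using sq[OF that] spectral_power_2[OF \<phi>] Line Point that by simp_all

  have eigenvalues: "e\<^sup>2 = (real d)\<^sup>2 \<or> e\<^sup>2 = real d \<or> e\<^sup>2 = 1" if e: "e \<in> set es" for e
  proof -
    obtain i where i: "i < length es" "e = es ! i" using e by (metis in_set_conv_nth)
    have ev: "(\<Sum>v\<in>?V. ?p 2 u v * \<phi> i v) = e\<^sup>2 * \<phi> i u" if "u \<in> ?V" for u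
      using eigenfunction_of_orthonormal[OF \<phi> V i(1) that] i(2) by simp
    have "(\<Sum>v\<in>?V. \<phi> i v * \<phi> i v) = 1" using \<phi> i by (simp add: orthonormal_eigenfunctions_def)
    then have "\<exists>v\<in>?V. \<phi> i v \<noteq> 0" by (rule contrapos_pp) simp
    then consider t where "t \<in> ?T" "\<phi> i (Line t) \<noteq> 0" | t where "t \<in> ?T" "\<phi> i (Point t) \<noteq> 0"
      using V_cases by metis
    then show ?thesis
    proof cases
      case 1
      show ?thesis unfolding d_def
      proof (rule incidence_square_eigenvalue[where g = "\<lambda>t. \<phi> i (Line t)"])
        fix s assume "s \<in> ?T"
        then show "(\<Sum>t\<in>?T. common_neighbours s t * \<phi> i (Line t)) = e\<^sup>2 * \<phi> i (Line s)"
          using ev[OF Line[OF \<open>s \<in> ?T\<close>]] by (simp add: V_sum p2)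
      qed (use 1 in auto)
    next
      case 2
      show ?thesis unfolding d_def
      proof (rule incidence_square_eigenvalue[where g = "\<lambda>t. \<phi> i (Point t)"])
        fix s assume "s \<in> ?T"
        then show "(\<Sum>t\<in>?T. common_neighbours s t * \<phi> i (Point t)) = e\<^sup>2 * \<phi> i (Point s)"
          using ev[OF Point[OF \<open>s \<in> ?T\<close>]] by (simp add: V_sum p2)
      qed (use 2 in auto)
    qed
  qed

  define s where "s = sqrt (real d)"
  have s1: "s > 1" using d2 by (simp add: s_def)
  have ds: "real d = s\<^sup>2" by (simp add: s_def)
  have sd: "s < real d" using s1 by (simp add: ds power2_eq_square)
  define S where "S = {real d, - real d, s, - s, 1, - 1}"
  have "set es \<subseteq> S"
  proof
    fix e assume "e \<in> set es"
    then consider "e\<^sup>2 = (real d)\<^sup>2" | "e\<^sup>2 = s\<^sup>2" | "e\<^sup>2 = 1\<^sup>2" using eigenvalues ds by fastforce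
    then show "e \<in> S" unfolding power2_eq_iff by cases (auto simp: S_def)
  qed
  define M where "M k = (\<Sum>e\<leftarrow>es. e ^ k)" for k :: nat
  let ?c = "\<lambda>x. real (count (mset es) x)"
  have M: "M k = ?c (real d) * real d ^ k + ?c (- real d) * (- real d) ^ k + ?c s * s ^ k
      + ?c (- s) * (- s) ^ k + ?c 1 * 1 ^ k + ?c (- 1) * (- 1) ^ k" for k
    unfolding M_def sum_list_count[OF _ \<open>set es \<subseteq> S\<close>, simplified S_def, simplified]
    using s1 sd by simp

  have card_T: "real (card ?T) = (real d)\<^sup>2 - 1"
    using d2 by (simp add: card_triples d_def of_nat_diff)
  have M0: "M 0 = 2 * ((real d)\<^sup>2 - 1)"
  proof -
    have "(\<Sum>v\<in>?V. ?p 0 v v) = 2 * real (card ?T)"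
      unfolding V_sum by (simp add: spectral_power_simps[OF \<phi>] Line Point)
    then show ?thesis using trace_spectral_power[OF \<phi>, of 0] card_T by (simp add: M_def)
  qed
  have M2: "M 2 = 2 * (real d * ((real d)\<^sup>2 - 1))"
    using trace_spectral_power[OF \<phi>, of 2] card_T
    by (simp add: M_def V_sum p2 common_neighbours_def d_def)
  have M4: "M 4 = 2 * (((real d)\<^sup>2 - 1) * (2 * (real d)\<^sup>2 - real d))"
  proof -
    have p4: "?p 4 v v = (\<Sum>w\<in>?V. (?p 2 v w)\<^sup>2)" for v
    proof -
      have "?p 2 w v = ?p 2 v w" for w by (simp add: spectral_power_def mult_ac)
      then show ?thesis
        using spectral_power_add[OF \<phi>, of 2 2 v v] by (simp add: power2_eq_square)
    qed
    have "?p 4 (Line t) (Line t) = 2 * (real d)\<^sup>2 - real d" if "t \<in> ?T" for t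
      using that sum_common_neighbours_squared[OF that] by (simp add: p4 V_sum p2 d_def)
    moreover have "?p 4 (Point t) (Point t) = 2 * (real d)\<^sup>2 - real d" if "t \<in> ?T" for t
      using that sum_common_neighbours_squared[OF that] by (simp add: p4 V_sum p2 d_def)
    ultimately show ?thesis
      using trace_spectral_power[OF \<phi>, of 4] card_T by (simp add: M_def V_sum)
  qed
  define side where "side v = (case v of Line _ \<Rightarrow> 1 | Point _ \<Rightarrow> (- 1 :: real))" for v :: "'f vertex"
  have "M k = 0" if "odd k" for k
    unfolding M_def
  proof (rule bipartite_odd_moment[OF \<phi>, of side])
    show "side v * side v = 1" for v by (simp add: side_def split: vertex.split)
    show "side u * ?a u v * side v = - ?a u v" for u v
      by (auto simp: side_def G_def split: vertex.split)
  qed (rule that)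
  then have Modd: "M 1 = 0" "M 3 = 0" "M 5 = 0" by simp_all
  note c = moment_equations[OF s1 ds M M0 Modd(1) M2 Modd(2) M4 Modd(3)]
  have "d + 2 \<le> d\<^sup>2"
  proof -
    have "d * 2 \<le> d * d" using d2 by simp
    then show ?thesis using d2 unfolding power2_eq_square by linarith
  qed
  then have nat: "(real d)\<^sup>2 - real d - 2 = real (d\<^sup>2 - d - 2)" by (simp add: of_nat_diff)
  have counts: "count (mset es) (real d) = 1" "count (mset es) (- real d) = 1"
    "count (mset es) s = d\<^sup>2 - d - 2" "count (mset es) (- s) = d\<^sup>2 - d - 2"
    "count (mset es) 1 = d" "count (mset es) (- 1) = d"
    using c unfolding nat by simp_all
  have "mset es = {# real d, - real d #} + replicate_mset (d\<^sup>2 - d - 2) s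
      + replicate_mset (d\<^sup>2 - d - 2) (- s) + replicate_mset d 1 + replicate_mset d (- 1)" (is "_ = ?R")
  proof (rule multiset_eqI)
    fix x
    show "count (mset es) x = count ?R x"
    proof (cases "x \<in> S")
      case True
      then show ?thesis using counts s1 sd by (auto simp: S_def)
    next
      case False
      then have "count (mset es) x = 0" using \<open>set es \<subseteq> S\<close> by (auto simp: count_mset_0_iff)
      then show ?thesis using False by (auto simp: S_def)
    qed
  qed
  then show ?thesis using es by (simp add: s_def)
qed

section \<open>Girth, diameter and algebraic connectivity of the line-point graph\<close>

text \<open>
  Two points determine at most one line; this is what excludes 4-cycles.
\<close>

lemma unique_common_incident:
  fixes s t p q :: "'f::{field, finite} triple"
  assumes "s \<in> triples" "t \<in> triples" "p \<in> triples" "q \<in> triples" "s \<noteq> t"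
    and "dot s p = 0" "dot t p = 0" "dot s q = 0" "dot t q = 0"
  shows "p = q"
proof -
  let ?S = "{p \<in> triples. dot s p = 0 \<and> dot t p = 0}"
  have "card {p, q} \<le> card ?S" using assms by (intro card_mono) auto
  also have "\<dots> \<le> 1" using card_common_incident[OF assms(1,2)] assms(5) by simp
  finally show ?thesis by (cases "p = q") auto
qed

lemma parcs_line_point_graphE:
  assumes "(u, v) \<in> parcs line_point_graph"
  obtains l p where "u = Line l" "v = Point p" "l \<in> triples" "p \<in> triples" "dot l p = 0"
  | l p where "u = Point p" "v = Line l" "l \<in> triples" "p \<in> triples" "dot l p = 0"
  using assms by (auto simp: line_point_graph_def simp del: split_paired_Ex)

lemma parity_line_point_graph:
  assumes "set w \<subseteq> parcs line_point_graph" "pcas u w v"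
  shows "even (length w) \<longleftrightarrow> (\<exists>s t. u = Line s \<and> v = Line t \<or> u = Point s \<and> v = Point t)"
  using assms
proof (induction w arbitrary: u)
  case Nil
  then show ?case by (cases u) auto
next
  case (Cons e w)
  obtain x where e: "e = (u, x)" using Cons.prems by (cases e) auto
  then have "(u, x) \<in> parcs line_point_graph" using Cons.prems by simp
  moreover have "even (length w) \<longleftrightarrow> (\<exists>s t. x = Line s \<and> v = Line t \<or> x = Point s \<and> v = Point t)"
    using Cons e by simp
  ultimately show ?case
    by (cases v) (auto elim!: parcs_line_point_graphE simp del: split_paired_Ex split_paired_All)
qed

lemma no_4_cycle_line_point_graph:
  fixes a b c e :: "'f::{field, finite} vertex"
  assumes "(a, b) \<in> parcs line_point_graph" "(b, c) \<in> parcs line_point_graph"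
    "(c, e) \<in> parcs line_point_graph" "(e, a) \<in> parcs line_point_graph" "a \<noteq> c"
  shows "b = e"
proof -
  from assms(1) show ?thesis
  proof (cases rule: parcs_line_point_graphE)
    case (1 l p)
    obtain l' where l': "c = Line l'" "l' \<in> triples" "dot l' p = 0"
      using assms(2) 1 by (auto elim: parcs_line_point_graphE)
    obtain q where q: "e = Point q" "q \<in> triples" "dot l' q = 0" "dot l q = 0"
      using assms(3,4) 1 l' by (auto elim!: parcs_line_point_graphE)
    show ?thesis using unique_common_incident[of l l' p q] 1 l' q assms(5) by simp
  next
    case (2 l p)
    obtain p' where p': "c = Point p'" "p' \<in> triples" "dot l p' = 0"
      using assms(2) 2 by (auto elim: parcs_line_point_graphE)
    obtain m where m: "e = Line m" "m \<in> triples" "dot m p' = 0" "dot m p = 0"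
      using assms(3,4) 2 p' by (auto elim!: parcs_line_point_graphE)
    show ?thesis using unique_common_incident[of p p' l m] 2 p' m assms(5)
      by (simp add: dot_commute)
  qed
qed

lemma cycle_line_point_graph:
  fixes G :: "'f::{field, finite} vertex pair_pre_digraph"
  defines "G \<equiv> line_point_graph"
  assumes cyc: "pre_digraph.cycle (with_proj G) w" and len: "3 \<le> length w"
  shows "6 \<le> length w"
proof (rule ccontr)
  assume "\<not> 6 \<le> length w"
  interpret pair_graph G unfolding G_def by (rule pair_graph_line_point_graph)
  from cyc obtain u where w: "set w \<subseteq> parcs G" "pcas u w u" "distinct (tl (pawalk_verts u w))"
    unfolding cycle_def awalk_def by blast
  have "even (length w)"
    using parity_line_point_graph[of w u u] w(1,2) by (cases u) (auto simp: G_def)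
  then have "length w = 4" using len \<open>\<not> 6 \<le> length w\<close> by presburger
  then obtain a b c e where "w = [a, b, c, e]"
    by (auto simp: numeral_eq_Suc length_Suc_conv)
  then obtain x1 x2 x3 where "w = [(u, x1), (x1, x2), (x2, x3), (x3, u)]" "distinct [x1, x2, x3, u]"
    using w(2,3) by (cases a; cases b; cases c; cases e) auto
  then show False using no_4_cycle_line_point_graph[of u x1 x2 x3] w(1) by (auto simp: G_def)
qed

text \<open>
  The triangle with vertices \<open>(1, 0)\<close>, \<open>(0, 1)\<close> and \<open>(1, 1)\<close> and its three sides, none of which
  passes through the origin in any characteristic.
\<close>

lemma hexagon_line_point_graph:
  fixes G :: "'f::{field, finite} vertex pair_pre_digraph"
  defines "G \<equiv> line_point_graph"
  shows "\<exists>w. pre_digraph.cycle (with_proj G) w \<and> length w = 6"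
proof -
  interpret pair_graph G unfolding G_def by (rule pair_graph_line_point_graph)
  let ?p = "Point (1, 1, 0)" and ?q = "Point (1, 0, 1)" and ?r = "Point (1, 1, 1)"
  let ?l = "Line (1, - 1, - 1)" and ?m = "Line (1, 0, - 1)" and ?n = "Line (1, - 1, 0)"
  let ?w = "[(?p, ?l), (?l, ?q), (?q, ?m), (?m, ?r), (?r, ?n), (?n, ?p)] :: ('f vertex \<times> 'f vertex) list"
  have "awalk ?p ?w ?p"
    unfolding awalk_def by (auto simp: G_def pverts_line_point_graph triples_iff)
  then have "cycle ?w" unfolding cycle_def by (intro exI[of _ ?p]) auto
  then show ?thesis by (intro exI[of _ ?w]) simp
qed

lemma girth_line_point_graph:
  "girth (line_point_graph :: 'f::{field, finite} vertex pair_pre_digraph) = 6"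
proof -
  let ?G = "line_point_graph :: 'f vertex pair_pre_digraph"
  obtain w where w: "pre_digraph.cycle (with_proj ?G) w" "length w = 6"
    using hexagon_line_point_graph by blast
  show ?thesis unfolding girth_def
  proof (rule antisym)
    show "(INF p\<in>{p. pre_digraph.cycle (with_proj ?G) p \<and> 3 \<le> length p}. enat (length p)) \<le> 6"
      by (rule INF_lower2[of w]) (use w in \<open>auto simp: numeral_eq_enat\<close>)
    show "6 \<le> (INF p\<in>{p. pre_digraph.cycle (with_proj ?G) p \<and> 3 \<le> length p}. enat (length p))"
      by (rule INF_greatest) (use cycle_line_point_graph in \<open>auto simp: numeral_eq_enat\<close>)
  qed
qed

lemma exists_not_parallel:
  fixes t :: "'f::field triple"
  assumes "t \<in> triples"
  shows "\<exists>s\<in>triples. \<not> parallel t s"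
proof -
  obtain b c where t: "t = (1, b, c)" "b \<noteq> 0 \<or> c \<noteq> 0" using assms by (rule triplesE)
  show ?thesis
    by (rule bexI[of _ "if b = 0 then (1, 1, 0) else (1, 0, 1)"]) (use t in \<open>auto simp: triples_iff\<close>)
qed

lemma exists_common_incident:
  fixes s t :: "'f::{field, finite} triple"
  assumes "s \<in> triples" "t \<in> triples" "\<not> parallel s t"
  shows "\<exists>p\<in>triples. dot s p = 0 \<and> dot t p = 0"
proof -
  have "card {p \<in> triples. dot s p = 0 \<and> dot t p = 0} = 1"
    using card_common_incident[OF assms(1,2)] assms(3) by (auto split: if_splits)
  then show ?thesis by (auto simp: card_1_singleton_iff simp del: split_paired_Ex)
qed

text \<open>
  The line \<open>l\<close> has at least two points, and two distinct points on it are never parallel, so at most one of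
  them is parallel to \<open>p\<close>.
\<close>

lemma exists_incident_not_parallel:
  fixes l p :: "'f::{field, finite} triple"
  assumes "l \<in> triples" "p \<in> triples"
  shows "\<exists>q\<in>triples. dot l q = 0 \<and> \<not> parallel p q"
proof (rule ccontr)
  assume *: "\<not> ?thesis"
  have "card {0 :: 'f, 1} \<le> card (UNIV :: 'f set)" by (rule card_mono) auto
  then have "\<not> card {q \<in> triples. dot l q = 0} \<le> Suc 0"
    using card_incident[OF assms(1)] by simp
  then obtain q r where qr: "q \<in> triples" "dot l q = 0" "r \<in> triples" "dot l r = 0" "q \<noteq> r"
    by (subst (asm) card_le_Suc0_iff_eq) (auto simp del: split_paired_All)
  then have "parallel q r" using * parallel_trans[OF assms(2), of q r] parallel_sym by blast
  moreover have "l \<in> {x \<in> triples. dot q x = 0 \<and> dot r x = 0}"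
    using qr assms(1) dot_commute[of q l] dot_commute[of r l] by simp
  then have "card {x \<in> triples. dot q x = 0 \<and> dot r x = 0} \<noteq> 0"
    by (subst card_eq_0_iff) (use finite in blast)
  ultimately show False using card_common_incident[OF qr(1,3)] qr(5) by simp
qed

text \<open>
  Vertices on the same side have distance at most \<open>2\<close> unless they are parallel; then a detour through a
  third, non-parallel vertex gives length \<open>4\<close>. On opposite sides, one step leads to a vertex not parallel
  to the target, and two more steps reach it.
\<close>

lemma walk_le_4_line_point_graph:
  fixes u v :: "'f::{field, finite} vertex"
  assumes "u \<in> pverts line_point_graph" "v \<in> pverts line_point_graph"
  shows "\<exists>w. set w \<subseteq> parcs line_point_graph \<and> pcas u w v \<and> length w \<le> 4"
proof -
  let ?E = "parcs (line_point_graph :: 'f vertex pair_pre_digraph)"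
  obtain X Y :: "'f triple \<Rightarrow> 'f vertex" and s
    where XY: "(X, Y) = (Line, Point) \<or> (X, Y) = (Point, Line)" and u: "u = X s" "s \<in> triples"
    using assms(1) unfolding pverts_line_point_graph by blast
  have E: "(X a, Y b) \<in> ?E" "(Y b, X a) \<in> ?E" if "a \<in> triples" "b \<in> triples" "dot a b = 0" for a b
    using XY that by (auto simp: dot_commute)
  obtain t where "t \<in> triples" "v = X t \<or> v = Y t"
    using assms(2) XY unfolding pverts_line_point_graph by blast
  then consider (same) "v = X t" "\<not> parallel s t" | (same_parallel) "v = X t" "parallel s t" | (opposite) "v = Y t"
    by blast
  then show ?thesis
  proof cases
    case same
    obtain p where "p \<in> triples" "dot s p = 0" "dot t p = 0"
      using exists_common_incident[OF u(2) \<open>t \<in> triples\<close> same(2)] by blast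
    then show ?thesis using u same E \<open>t \<in> triples\<close>
      by (intro exI[of _ "[(X s, Y p), (Y p, X t)]"]) simp
  next
    case same_parallel
    obtain r where r: "r \<in> triples" "\<not> parallel s r" using exists_not_parallel[OF u(2)] by blast
    then have "\<not> parallel r t"
      using parallel_trans[OF \<open>t \<in> triples\<close>, of s r] same_parallel(2) parallel_sym by blast
    then obtain p q where "p \<in> triples" "dot s p = 0" "dot r p = 0" "q \<in> triples" "dot r q = 0" "dot t q = 0"
      using exists_common_incident[OF u(2) r] exists_common_incident[OF r(1) \<open>t \<in> triples\<close>] by blast
    then show ?thesis using u same_parallel E \<open>t \<in> triples\<close> r
      by (intro exI[of _ "[(X s, Y p), (Y p, X r), (X r, Y q), (Y q, X t)]"]) simp
  next
    case opposite
    obtain q where q: "q \<in> triples" "dot s q = 0" "\<not> parallel t q"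
      using exists_incident_not_parallel[OF u(2) \<open>t \<in> triples\<close>] by blast
    obtain m where "m \<in> triples" "dot t m = 0" "dot q m = 0"
      using exists_common_incident[OF \<open>t \<in> triples\<close> q(1,3)] by blast
    then show ?thesis using u opposite E \<open>t \<in> triples\<close> q
      by (intro exI[of _ "[(X s, Y q), (Y q, X m), (X m, Y t)]"]) (simp add: dot_commute)
  qed
qed

lemma parallel_lines_distance:
  fixes s t :: "'f::{field, finite} triple"
  assumes st: "s \<in> triples" "t \<in> triples" "parallel s t" "s \<noteq> t"
    and w: "set w \<subseteq> parcs line_point_graph" "pcas (Line s) w (Line t)"
  shows "4 \<le> length w"
proof (rule ccontr)
  assume "\<not> 4 \<le> length w"
  moreover have "even (length w)" using parity_line_point_graph[OF w] by blast
  ultimately have "length w = 0 \<or> length w = 2" by presburger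
  then consider "w = []" | e e' where "w = [e, e']" by (auto simp: numeral_2_eq_2 length_Suc_conv)
  then show False
  proof cases
    case 1
    then show False using w st by simp
  next
    case 2
    then obtain x where "w = [(Line s, x), (x, Line t)]" using w by (cases e; cases e') auto
    then obtain p where "p \<in> triples" "dot s p = 0" "dot t p = 0"
      using w(1) by (auto elim!: parcs_line_point_graphE)
    then have "card {p \<in> triples. dot s p = 0 \<and> dot t p = 0} \<noteq> 0"
      by (auto simp del: split_paired_All split_paired_Ex)
    then show False using card_common_incident[OF st(1,2)] st by simp
  qed
qed

lemma diameter_line_point_graph:
  assumes "card (UNIV :: 'f::{field, finite} set) > 2"
  shows "graph_diameter (line_point_graph :: 'f vertex pair_pre_digraph) = 4"
proof -
  let ?G = "line_point_graph :: 'f vertex pair_pre_digraph"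
  interpret pair_graph ?G by (rule pair_graph_line_point_graph)
  have wf: "pair_wf_digraph ?G" by unfold_locales
  have "\<not> UNIV \<subseteq> {0 :: 'f, 1}"
  proof
    assume "UNIV \<subseteq> {0 :: 'f, 1}"
    then have "card (UNIV :: 'f set) \<le> card {0 :: 'f, 1}" by (intro card_mono) auto
    then show False using assms by simp
  qed
  then obtain k :: 'f where k: "k \<noteq> 0" "k \<noteq> 1" by blast
  \<comment> \<open>Two distinct parallel triples; a third field element is needed to have them.\<close>
  let ?s = "(1, 1, 0) :: 'f triple" and ?t = "(1, k, 0) :: 'f triple"
  have st: "?s \<in> triples" "?t \<in> triples" "parallel ?s ?t" "?s \<noteq> ?t" using k by (auto simp: triples_iff)
  show ?thesis
  proof (rule antisym)
    show "graph_diameter ?G \<le> 4"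
      unfolding graph_diameter_def
    proof (intro SUP_least)
      fix u v assume uv: "u \<in> pverts ?G" "v \<in> pverts ?G"
      obtain w where w: "set w \<subseteq> parcs ?G" "pcas u w v" "length w \<le> 4"
        using walk_le_4_line_point_graph[OF uv] by blast
      have "\<mu> (\<lambda>_. 1) u v \<le> ereal (length w)" by (rule mu_le_length[OF wf uv(1) w(1,2)])
      also have "\<dots> \<le> 4" using w(3) by simp
      finally show "\<mu> (\<lambda>_. 1) u v \<le> 4" .
    qed
    have "ereal (real 4) \<le> \<mu> (\<lambda>_. 1) (Line ?s) (Line ?t)"
      by (rule le_mu[OF wf]) (rule parallel_lines_distance[OF st])
    then show "4 \<le> graph_diameter ?G"
      unfolding graph_diameter_def
      by (intro SUP_upper2[of "Line ?s"] SUP_upper2[of "Line ?t"])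
        (use st in \<open>auto simp: pverts_line_point_graph\<close>)
  qed
qed

lemma second_of_sorted_list_of_multiset:
  fixes a b :: "'a::linorder"
  assumes "a \<le> b" "\<And>x. x \<in># R \<Longrightarrow> b \<le> x"
  shows "sorted_list_of_multiset ({#a, b#} + R) ! 1 = b"
proof -
  have "insort b (sorted_list_of_multiset R) = b # sorted_list_of_multiset R"
    using assms(2) by (intro insort_is_Cons) auto
  moreover have "insort a (b # sorted_list_of_multiset R) = a # b # sorted_list_of_multiset R"
    using assms(1) by simp
  ultimately show ?thesis by simp
qed

lemma algebraic_connectivity_line_point_graph:
  fixes G :: "'f::{field, finite} vertex pair_pre_digraph"
  defines "d \<equiv> card (UNIV :: 'f set)" and "G \<equiv> line_point_graph"
  assumes d: "d > 2"
  shows "algebraic_connectivity G = d - sqrt d"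
proof -
  have G: "pair_graph G" unfolding G_def by (rule pair_graph_line_point_graph)
  have reg: "regular_graph d G" unfolding G_def d_def by (rule regular_line_point_graph)
  let ?n = "length (vertex_list G)"
  have A: "adjacency_matrix G \<in> carrier_mat ?n ?n" by (simp add: adjacency_matrix_adj)
  have At: "transpose_mat (adjacency_matrix G) = adjacency_matrix G"
    by (rule eq_matI) (auto simp: adjacency_matrix_adj adj_sym[OF G])
  define k where "k = d\<^sup>2 - d - 2"
  define s where "s = sqrt (real d)"
  have s1: "1 \<le> s" using d by (simp add: s_def)
  have sd: "s \<le> real d" using d by (simp add: s_def sqrt_le_D power2_eq_square real_le_lsqrt)
  have "d * 3 \<le> d * d" using d by simp
  then have "k \<noteq> 0" using d unfolding k_def power2_eq_square by linarith
  \<comment> \<open>One copy of \<open>d - sqrt d\<close> is split off to become the second entry of the sorted list.\<close>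
  then obtain j where j: "k = Suc j" using not0_implies_Suc by blast
  have "spectrum_mset (laplacian_matrix G) = image_mset (\<lambda>x. real d - x)
      ({# real d, - real d #} + replicate_mset k s + replicate_mset k (- s)
        + replicate_mset d 1 + replicate_mset d (- 1))"
    unfolding laplacian_matrix_def degree_matrix_regular[OF G reg] spectrum_mset_reflect[OF A At]
    using spectrum_line_point_graph[where 'f = 'f] by (simp add: G_def d_def k_def s_def)
  also have "\<dots> = {# 0, real d - s #} + ({# 2 * real d #} + replicate_mset j (real d - s)
      + replicate_mset k (real d + s) + replicate_mset d (real d - 1) + replicate_mset d (real d + 1))"
    by (simp add: j)
  finally have spec: "spectrum_mset (laplacian_matrix G) = \<dots>" .
  show ?thesis
    unfolding algebraic_connectivity_def spec s_def[symmetric]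
    by (rule second_of_sorted_list_of_multiset) (use s1 sd in \<open>auto split: if_splits\<close>)
qed

theorem mainTheorem6:
  fixes d :: nat and G :: "'f::{field, finite} vertex pair_pre_digraph"
  assumes "primepow d" and "card (UNIV :: 'f set) = d"
    and "G = line_point_graph"
  shows "pair_graph G
    \<and> regular_graph d G
    \<and> card (pverts G) = 2 * d\<^sup>2 - 2
    \<and> girth G = 6
    \<and> spectrum_mset (adjacency_matrix G) =
        {# real d, - real d #}
        + replicate_mset (d\<^sup>2 - d - 2) (sqrt d) + replicate_mset (d\<^sup>2 - d - 2) (- sqrt d)
        + replicate_mset d 1 + replicate_mset d (- 1)
    \<and> (d \<noteq> 2 \<longrightarrow> graph_diameter G = 4 \<and> algebraic_connectivity G = d - sqrt d)
    \<and> (\<forall>H :: 'v pair_pre_digraph.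
          pair_graph H \<and> regular_graph d H \<and> graph_diameter H = 4
            \<longrightarrow> algebraic_connectivity H \<le> d - sqrt d)"
proof -
  have "d > 1" using assms(1) by (rule primepow_gt_Suc_0[unfolded One_nat_def[symmetric]])
  then have "d \<noteq> 2 \<longrightarrow> d > 2" by simp
  then show ?thesis
    using \<open>d > 1\<close> pair_graph_line_point_graph[where 'f = 'f] regular_line_point_graph[where 'f = 'f]
      card_vertices_line_point_graph[where 'f = 'f] girth_line_point_graph[where 'f = 'f]
      spectrum_line_point_graph[where 'f = 'f] diameter_line_point_graph[where 'f = 'f]
      algebraic_connectivity_line_point_graph[where 'f = 'f]
      algebraic_connectivity_le_if_diameter_4[where 'v = 'v and d = d]
    unfolding assms(2,3) by simp
qed

end
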